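(* Let $0<\beta<1$, $0<\alpha<n$ with $0<\alpha+\beta<n$, and let $b$ be a locally integrable function on $\mathbb{R}^n$. Then the following statements are equivalent: (1) $b\in\dot{\Lambda}_{\beta}(\mathbb{R}^n)$. (2) $M_{\alpha,b}$ is bounded from $L^{p(\cdot)}(\mathbb{R}^n)$ to $L^{q(\cdot)}(\mathbb{R}^n)$ for some pair $(p(\cdot),q(\cdot))\in\mathscr{B}^{\alpha+\beta}(\mathbb{R}^n)$. (3) $M_{\alpha,b}$ is bounded from $L^{p(\cdot)}(\mathbb{R}^n)$ to $L^{q(\cdot)}(\mathbb{R}^n)$ for all pairs $(p(\cdot),q(\cdot))\in\mathscr{B}^{\alpha+\beta}(\mathbb{R}^n)$. (4) There exists $s(\cdot)\in\mathscr{B}(\mathbb{R}^n)$ such that $$\sup_{Q}\frac{1}{|Q|^{\beta/n}}\frac{\|(b-b_Q)\chi_Q\|_{L^{s(\cdot)}(\mathbb{R}^n)}}{\|\chi_Q\|_{L^{s(\cdot)}(\mathbb{R}^n)}}<\infty,$$ where the supremum is over all cubes $Q\subset\mathbb{R}^n$. (5) The condition in (4) holds for every $s(\cdot)\in\mathscr{B}(\mathbb{R}^n)$.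
   Context: Cubes $Q\subset\mathbb{R}^n$ have sides parallel to the coordinate axes; $|Q|$ is Lebesgue measure, $\chi_Q$ the characteristic function and $b_Q=|Q|^{-1}\int_Qb$. For $0\le\alpha<n$ the maximal commutator is $M_{\alpha,b}(f)(x)=\sup_{Q\ni x}|Q|^{\alpha/n-1}\int_Q|b(x)-b(y)||f(y)|\,dy$ (supremum over cubes containing $x$). $M$ denotes the Hardy–Littlewood maximal function $M(f)(x)=\sup_{Q\ni x}|Q|^{-1}\int_Q|f|$. For $0<\beta<1$, $\dot{\Lambda}_\beta(\mathbb{R}^n)$ is the set of functions $b$ with $|b(x)-b(y)|\le C|x-y|^\beta$ for all $x,y$. For measurable $p(\cdot):\mathbb{R}^n\to[1,\infty)$, $L^{p(\cdot)}(\mathbb{R}^n)$ is the space of measurable $f$ with $\int(|f(x)|/\lambda)^{p(x)}dx<\infty$ for some $\lambda>0$, normed by $\|f\|_{L^{p(\cdot)}}=\inf\{\lambda>0:\int(|f(x)|/\lambda)^{p(x)}dx\le1\}$. $\mathscr{P}(\mathbb{R}^n)$ is the set of measurable $p(\cdot):\mathbb{R}^n\to[1,\infty)$ with $1<\operatorname{ess\,inf}p$ and $p_+:=\operatorname{ess\,sup}p<\infty$; $\mathscr{B}(\mathbb{R}^n)$ is the set of $p(\cdot)\in\mathscr{P}(\mathbb{R}^n)$ such that $M$ is bounded on $L^{p(\cdot)}(\mathbb{R}^n)$. For $0<\gamma<n$, $(p(\cdot),q(\cdot))\in\mathscr{B}^\gamma(\mathbb{R}^n)$ means $p(\cdot)\in\mathscr{P}(\mathbb{R}^n)$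 with $p_+<n/\gamma$, $1/q(\cdot)=1/p(\cdot)-\gamma/n$, and $q(\cdot)(n-\gamma)/n\in\mathscr{B}(\mathbb{R}^n)$. Bounded from $L^{p(\cdot)}$ to $L^{q(\cdot)}$ means $\|T(f)\|_{L^{q(\cdot)}}\le C\|f\|_{L^{p(\cdot)}}$ for all $f\in L^{p(\cdot)}$.
   Formalization: Statement (1) is read as: b agrees almost everywhere with a function in the Lipschitz class. Read pointwise, (2)⇒(1) fails, e.g. for b the characteristic function of a single point. The relation 1/q = 1/p − γ/n is required almost everywhere. *)

theory Defs
  imports "HOL-Analysis.Analysis"
begin

definition cube :: "'a::euclidean_space set \<Rightarrow> bool" where
  "cube Q \<longleftrightarrow> (\<exists>a l. l > 0 \<and> Q = cbox a (a + l *\<^sub>R One))"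

definition vmodular :: "('a::euclidean_space \<Rightarrow> real) \<Rightarrow> ('a \<Rightarrow> ennreal) \<Rightarrow> ennreal" where
  "vmodular p g = (\<integral>\<^sup>+ x. (if g x = \<infinity> then \<infinity> else ennreal (enn2real (g x) powr p x)) \<partial>lebesgue)"

text \<open>Luxemburg norm of the function g (applied to |f|); equals \<infinity> if no admissible \<lambda>.\<close>
definition vnorm :: "('a::euclidean_space \<Rightarrow> real) \<Rightarrow> ('a \<Rightarrow> ennreal) \<Rightarrow> ennreal" where
  "vnorm p g = (INF t\<in>{t::real. t > 0 \<and> vmodular p (\<lambda>x. g x / ennreal t) \<le> 1}. ennreal t)"

definition absf :: "('a \<Rightarrow> real) \<Rightarrow> 'a \<Rightarrow> ennreal" where
  "absf f = (\<lambda>x. ennreal \<bar>f x\<bar>)"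

definition in_Lvar :: "('a::euclidean_space \<Rightarrow> real) \<Rightarrow> ('a \<Rightarrow> real) \<Rightarrow> bool" where
  "in_Lvar p f \<longleftrightarrow> f \<in> borel_measurable lebesgue \<and> vnorm p (absf f) < \<infinity>"

definition bounded_var :: "(('a::euclidean_space \<Rightarrow> real) \<Rightarrow> 'a \<Rightarrow> ennreal)
     \<Rightarrow> ('a \<Rightarrow> real) \<Rightarrow> ('a \<Rightarrow> real) \<Rightarrow> bool" where
  "bounded_var T p q \<longleftrightarrow> (\<exists>C::real. \<forall>f. in_Lvar p f \<longrightarrow> vnorm q (T f) \<le> ennreal C * vnorm p (absf f))"

definition HLmax :: "('a::euclidean_space \<Rightarrow> real) \<Rightarrow> 'a \<Rightarrow> ennreal" where
  "HLmax f x = (SUP Q\<in>{Q. cube Q \<and> x \<in> Q}.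
      ennreal (1 / measure lebesgue Q) * (\<integral>\<^sup>+ y. ennreal \<bar>f y\<bar> * indicator Q y \<partial>lebesgue))"

definition maxcomm :: "real \<Rightarrow> ('a::euclidean_space \<Rightarrow> real) \<Rightarrow> ('a \<Rightarrow> real) \<Rightarrow> 'a \<Rightarrow> ennreal" where
  "maxcomm \<alpha> b f x = (SUP Q\<in>{Q. cube Q \<and> x \<in> Q}.
      ennreal (measure lebesgue Q powr (\<alpha> / real DIM('a) - 1)) *
      (\<integral>\<^sup>+ y. ennreal (\<bar>b x - b y\<bar> * \<bar>f y\<bar>) * indicator Q y \<partial>lebesgue))"

definition Pvar :: "('a::euclidean_space \<Rightarrow> real) \<Rightarrow> bool" where
  "Pvar p \<longleftrightarrow> p \<in> borel_measurable lebesgue \<and> (\<forall>x. 1 \<le> p x) \<and>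
     (\<exists>p0>1. AE x in lebesgue. p0 \<le> p x) \<and> (\<exists>P. AE x in lebesgue. p x \<le> P)"

definition Bvar :: "('a::euclidean_space \<Rightarrow> real) \<Rightarrow> bool" where
  "Bvar p \<longleftrightarrow> Pvar p \<and> bounded_var HLmax p p"

definition Bgamma :: "real \<Rightarrow> ('a::euclidean_space \<Rightarrow> real) \<Rightarrow> ('a \<Rightarrow> real) \<Rightarrow> bool" where
  "Bgamma \<gamma> p q \<longleftrightarrow> Pvar p \<and> (\<exists>P < real DIM('a) / \<gamma>. AE x in lebesgue. p x \<le> P) \<and>
     (AE x in lebesgue. 1 / q x = 1 / p x - \<gamma> / real DIM('a)) \<and>
     Bvar (\<lambda>x. q x * (real DIM('a) - \<gamma>) / real DIM('a))"

definition Lip_hom :: "real \<Rightarrow> ('a::euclidean_space \<Rightarrow> real) \<Rightarrow> bool" where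
  "Lip_hom \<beta> b \<longleftrightarrow> (\<exists>C. \<forall>x y. \<bar>b x - b y\<bar> \<le> C * dist x y powr \<beta>)"

definition locally_integrable :: "('a::euclidean_space \<Rightarrow> real) \<Rightarrow> bool" where
  "locally_integrable b \<longleftrightarrow> (\<forall>K. compact K \<longrightarrow> set_integrable lebesgue K b)"

definition avg :: "('a::euclidean_space \<Rightarrow> real) \<Rightarrow> 'a set \<Rightarrow> real" where
  "avg b Q = (LINT y:Q|lebesgue. b y) / measure lebesgue Q"

definition osc_sup :: "real \<Rightarrow> ('a::euclidean_space \<Rightarrow> real) \<Rightarrow> ('a \<Rightarrow> real) \<Rightarrow> ennreal" where
  "osc_sup \<beta> s b = (SUP Q\<in>{Q. cube Q}.
      ennreal (1 / measure lebesgue Q powr (\<beta> / real DIM('a))) *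
      vnorm s (absf (\<lambda>x. (b x - avg b Q) * indicator Q x)) / vnorm s (absf (indicator Q)))"

end

theory Submission
  imports Defs
begin

text \<open>
  Smoothness of \<open>b\<close> gives \<open>|b x - b y| \<le> C |Q|^(\<beta>/n)\<close> for \<open>x, y \<in> Q\<close>, which dominates the commutator by the
  fractional maximal function of order \<open>\<gamma> = \<alpha> + \<beta>\<close>. With \<open>r = q (n - \<gamma>) / n\<close>, \<open>\<theta> = 1 - \<gamma>/n\<close> and
  \<open>g = |f|^(p/r)\<close> one has \<open>|f| = g^\<theta> (|f|^p)^(1-\<theta>)\<close> pointwise, so Hoelder's inequality bounds the
  fractional maximal function of \<open>f\<close> by \<open>(M g)^\<theta>\<close> when the modular of \<open>f\<close> is at most 1, and
  boundedness of \<open>M\<close> on the space of exponent \<open>r\<close> suffices. Conversely, testing the commutator on \<open>\<chi>_Q\<close>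
  and comparing the norms of \<open>\<chi>_Q\<close> for \<open>p\<close> and \<open>q\<close> (Young's inequality) gives the oscillation
  condition for \<open>q\<close>; testing \<open>M\<close> on \<open>(b - b_Q) \<chi>_Q\<close> turns an oscillation condition in any admissible
  exponent into the one in the mean over cubes, and Campanato's theorem yields smoothness.
  Admissible exponents exist because \<open>M\<close> is bounded on the classical space of exponent 2.
\<close>

section \<open>The Luxemburg norm and domination by the maximal function\<close>

text \<open>For a variable exponent the norm is not a function of the modular; the two are tied
  together only at the value 1. The upper bounds are therefore reduced to the form "modular at most
  1 implies modular at most 1", where a relation such as \<open>q = r / \<theta>\<close> between
  exponents can be used pointwise under the integral. The same normalisation helps in Hoelder's
  inequality: the integral of |f|^p over a cube is at most 1, so its power disappears. Maximal
  functions may be infinite, hence domination by \<open>(M g)^\<theta>\<close> is phrased through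
  real upper bounds \<open>m\<close> of \<open>M g\<close>, and the estimates of norms rest on
  monotonicity of the integral. The converse direction uses no duality: \<open>M\<close> itself
  bounds averages by norms, since on a cube \<open>M h\<close> is at least the average of |h| there.
  Conditions (2) to (5) see \<open>b\<close> only up to null sets, so smoothness is proved for a
  representative. It is built from averages of \<open>b\<close>, and its equality with
  \<open>b\<close> almost everywhere comes from subdividing cubes, not from a differentiation
  theorem.\<close>

definition epowr :: "ennreal \<Rightarrow> real \<Rightarrow> ennreal" where
  "epowr u a = (if u = \<infinity> then \<infinity> else ennreal (enn2real u powr a))"

lemma vmodular_epowr: "vmodular p g = (\<integral>\<^sup>+ x. epowr (g x) (p x) \<partial>lebesgue)"
  by (simp add: vmodular_def epowr_def)

lemma epowr_ennreal: "0 \<le> u \<Longrightarrow> epowr (ennreal u) a = ennreal (u powr a)"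
  by (simp add: epowr_def)

lemma epowr_0 [simp]: "epowr 0 a = 0"
  by (simp add: epowr_def)

lemma epowr_mono: "u \<le> v \<Longrightarrow> 0 \<le> a \<Longrightarrow> epowr u a \<le> epowr v a"
  by (cases u; cases v) (auto simp: epowr_def top_unique intro!: ennreal_leI powr_mono2)

lemma vmodular_mono_AE:
  assumes "AE x in lebesgue. g x \<le> h x" "AE x in lebesgue. 0 \<le> p x"
  shows "vmodular p g \<le> vmodular p h"
  unfolding vmodular_epowr
proof (rule nn_integral_mono_AE)
  show "AE x in lebesgue. epowr (g x) (p x) \<le> epowr (h x) (p x)"
    using assms by eventually_elim (rule epowr_mono)
qed

lemma vnorm_le: "0 < t \<Longrightarrow> vmodular p (\<lambda>x. g x / ennreal t) \<le> 1 \<Longrightarrow> vnorm p g \<le> ennreal t"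
  unfolding vnorm_def by (rule INF_lower) simp

text \<open>An infimum below \<open>t\<close> has an admissible \<open>s\<close> below
  \<open>t\<close>, and the modular decreases as the scaling grows. The strict inequality avoids
  asking whether the infimum is attained; later proofs take \<open>t\<close> slightly above the norm
  and let the excess tend to 0.\<close>

lemma vmodular_le_1_if_vnorm_less:
  assumes "vnorm p g < ennreal t" "AE x in lebesgue. 0 \<le> p x"
  shows "vmodular p (\<lambda>x. g x / ennreal t) \<le> 1"
proof -
  obtain s where s: "0 < s" "vmodular p (\<lambda>x. g x / ennreal s) \<le> 1" "ennreal s < ennreal t"
    using assms(1) unfolding vnorm_def INF_less_iff by auto
  have "s < t" "0 < t" using s by (simp_all add: ennreal_less_iff)
  then have "vmodular p (\<lambda>x. g x / ennreal t) \<le> vmodular p (\<lambda>x. g x / ennreal s)"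
    by (intro vmodular_mono_AE assms AE_I2) (auto simp: divide_ennreal_def s(1) inverse_ennreal intro!: mult_left_mono ennreal_leI)
  with s show ?thesis by simp
qed

lemma ennreal_divide_mult_ennreal:
  assumes "0 < c" "0 < t"
  shows "ennreal c * u / ennreal (c * t) = u / ennreal t"
  using assms
  by (cases u) (auto simp: ennreal_mult' [symmetric] divide_ennreal ennreal_top_mult ennreal_mult_top ennreal_top_divide)

lemma vnorm_le_cmult:
  assumes "AE x in lebesgue. g x \<le> ennreal c * h x" "0 < c" "AE x in lebesgue. 0 \<le> p x"
  shows "vnorm p g \<le> ennreal c * vnorm p h"
proof (cases "vnorm p h")
  case (real n)
  show ?thesis
  proof (rule ennreal_le_epsilon)
    fix e :: real assume e: "0 < e"
    \<comment> \<open>The excess over the norm of \<open>h\<close> is \<open>e / c\<close>, so that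
      \<open>c * t\<close> exceeds \<open>c\<close> times the norm by exactly
      \<open>e\<close>.\<close>
    define t where "t = n + e / c"
    have t: "0 < t" "vnorm p h < ennreal t"
      using real e assms(2) by (auto simp: t_def ennreal_less_iff add_nonneg_pos)
    have "vmodular p (\<lambda>x. g x / ennreal (c * t)) \<le> vmodular p (\<lambda>x. h x / ennreal t)"
    proof (rule vmodular_mono_AE)
      show "AE x in lebesgue. g x / ennreal (c * t) \<le> h x / ennreal t"
        using assms(1)
      proof eventually_elim
        case (elim x)
        have "g x / ennreal (c * t) \<le> ennreal c * h x / ennreal (c * t)"
          by (rule divide_right_mono_ennreal) (rule elim)
        then show ?case using ennreal_divide_mult_ennreal[OF assms(2) t(1)] by simp
      qed
    qed fact
    also have "\<dots> \<le> 1" by (rule vmodular_le_1_if_vnorm_less[OF t(2) assms(3)])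
    finally have "vnorm p g \<le> ennreal (c * t)" using t assms by (intro vnorm_le) auto
    also have "\<dots> = ennreal c * vnorm p h + ennreal e"
      using real assms e by (simp add: t_def distrib_left ennreal_mult'[symmetric] ennreal_plus[symmetric] del: ennreal_plus)
    finally show "vnorm p g \<le> ennreal c * vnorm p h + ennreal e" .
  qed
next
  case top
  then show ?thesis using assms by (simp add: ennreal_mult_top)
qed

lemma absf_divide: "0 < t \<Longrightarrow> absf (\<lambda>x. f x / t) = (\<lambda>x. absf f x / ennreal t)"
  by (auto simp: absf_def divide_ennreal)

lemma Pvar_ge_1: "Pvar p \<Longrightarrow> 1 \<le> p x"
  and Pvar_measurable: "Pvar p \<Longrightarrow> p \<in> borel_measurable lebesgue"
  by (auto simp: Pvar_def)

lemma Bvar_imp_Pvar: "Bvar p \<Longrightarrow> Pvar p"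
  by (simp add: Bvar_def)

lemma Bvar_HLmax_modular:
  assumes "Bvar r"
  obtains C where "0 < C"
    "\<And>g. g \<in> borel_measurable lebesgue \<Longrightarrow> vmodular r (absf g) \<le> 1 \<Longrightarrow>
       vmodular r (\<lambda>x. HLmax g x / ennreal C) \<le> 1"
proof -
  obtain C0 where C0: "\<And>f. in_Lvar r f \<Longrightarrow> vnorm r (HLmax f) \<le> ennreal C0 * vnorm r (absf f)"
    using assms unfolding Bvar_def bounded_var_def by blast
  have nn: "AE x in lebesgue. 0 \<le> r x"
    using Pvar_ge_1[OF Bvar_imp_Pvar[OF assms]] by (intro AE_I2) (meson order_trans zero_le_one)
  show ?thesis
  proof (rule that)
    \<comment> \<open>\<open>max C0 0\<close> makes the constant nonnegative; adding 1 makes it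
      positive and the final norm bound strict, as the passage from norm to modular demands.\<close>
    show "0 < max C0 0 + 1" by simp
  next
    fix g :: "'a \<Rightarrow> real" assume g: "g \<in> borel_measurable lebesgue" "vmodular r (absf g) \<le> 1"
    have n: "vnorm r (absf g) \<le> 1"
      using vnorm_le[of 1 r "absf g"] g by (simp add: divide_ennreal_def)
    then have "in_Lvar r g" using g by (auto simp: in_Lvar_def intro: le_less_trans)
    then have "vnorm r (HLmax g) \<le> ennreal C0 * vnorm r (absf g)" by (rule C0)
    also have "\<dots> \<le> ennreal (max C0 0) * 1" by (intro mult_mono n ennreal_leI) auto
    also have "\<dots> < ennreal (max C0 0 + 1)" by (simp add: ennreal_less_iff del: ennreal_plus)
    finally show "vmodular r (\<lambda>x. HLmax g x / ennreal (max C0 0 + 1)) \<le> 1"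
      by (rule vmodular_le_1_if_vnorm_less[OF _ nn])
  qed
qed

text \<open>The last hypothesis is \<open>h \<le> K * H^\<theta>\<close>, expressed with real bounds
  \<open>m\<close> of \<open>H\<close>, so an infinite \<open>H\<close> asks for nothing. Dividing
  by \<open>K * C powr \<theta>\<close> and raising to the power \<open>r / \<theta>\<close> turns
  it into a comparison of two modular integrands.\<close>

lemma epowr_divide_le:
  assumes "0 < C" "0 < \<theta>" "0 < K" "0 < r"
    and h: "\<And>m. 0 < m \<Longrightarrow> H \<le> ennreal m \<Longrightarrow> h \<le> ennreal (K * m powr \<theta>)"
  shows "epowr (h / ennreal (K * C powr \<theta>)) (r / \<theta>) \<le> epowr (H / ennreal C) r"
proof (cases H)
  case top
  then show ?thesis using \<open>0 < C\<close> by (simp add: epowr_def ennreal_top_divide)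
next
  case (real m)
  show ?thesis
  proof (cases "m = 0")
    case True
    \<comment> \<open>Bounds are available only for positive \<open>m\<close>, so
      \<open>H = 0\<close> requires small \<open>m\<close>; the value inserted makes
      \<open>K * m powr \<theta>\<close> equal to \<open>e\<close>.\<close>
    have "h \<le> 0 + ennreal e" if "0 < e" for e
      using h[of "(e / K) powr (1 / \<theta>)"] that assms True real by (simp add: powr_powr)
    then have "h = 0" using ennreal_le_epsilon[of 0 h] by simp
    then show ?thesis by simp
  next
    case False
    then have m: "0 < m" using real by simp
    have "h / ennreal (K * C powr \<theta>) \<le> ennreal (K * m powr \<theta>) / ennreal (K * C powr \<theta>)"
      using h[OF m] real by (intro divide_right_mono_ennreal) simp
    also have "\<dots> = ennreal ((m / C) powr \<theta>)"
      using assms m by (simp add: divide_ennreal powr_divide)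
    finally have "epowr (h / ennreal (K * C powr \<theta>)) (r / \<theta>) \<le> epowr (ennreal ((m / C) powr \<theta>)) (r / \<theta>)"
      using assms by (intro epowr_mono) auto
    also have "\<dots> = epowr (H / ennreal C) r"
      using assms m real by (simp add: epowr_ennreal powr_powr divide_ennreal)
    finally show ?thesis .
  qed
qed

text \<open>By homogeneity it suffices to treat functions of modular at most 1: every
  \<open>t\<close> above the norm normalises \<open>f\<close>, and \<open>t\<close> then descends to
  the norm.\<close>

lemma bounded_varI:
  assumes L: "0 < L" and p: "AE x in lebesgue. 0 \<le> p x" and q: "AE x in lebesgue. 0 \<le> q x"
    and mod: "\<And>f. f \<in> borel_measurable lebesgue \<Longrightarrow> vmodular p (absf f) \<le> 1 \<Longrightarrow>
       vmodular q (\<lambda>x. T f x / ennreal L) \<le> 1"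
    and hom: "\<And>f t x. f \<in> borel_measurable lebesgue \<Longrightarrow> 0 < t \<Longrightarrow> T f x \<le> ennreal t * T (\<lambda>y. f y / t) x"
  shows "bounded_var T p q"
  unfolding bounded_var_def
proof (intro exI allI impI)
  fix f assume "in_Lvar p f"
  then have f: "f \<in> borel_measurable lebesgue" "vnorm p (absf f) < \<infinity>" by (auto simp: in_Lvar_def)
  obtain n where n: "0 \<le> n" "vnorm p (absf f) = ennreal n"
    using f(2) by (cases "vnorm p (absf f)") auto
  have le: "vnorm q (T f) \<le> ennreal (L * t)" if t: "n < t" for t
  proof -
    have t0: "0 < t" using n t by simp
    have "vmodular p (absf (\<lambda>y. f y / t)) \<le> 1"
      using vmodular_le_1_if_vnorm_less[of p "absf f" t] p n t t0 by (simp add: absf_divide ennreal_less_iff)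
    then have "vnorm q (T (\<lambda>y. f y / t)) \<le> ennreal L"
      using f by (intro vnorm_le L mod) auto
    moreover have "vnorm q (T f) \<le> ennreal t * vnorm q (T (\<lambda>y. f y / t))"
      by (rule vnorm_le_cmult) (use hom[OF f(1) t0] t0 q in auto)
    ultimately have "vnorm q (T f) \<le> ennreal t * ennreal L" by (meson mult_left_mono order_trans zero_le)
    then show ?thesis using L t0 by (simp add: ennreal_mult'[symmetric] mult.commute)
  qed
  show "vnorm q (T f) \<le> ennreal L * vnorm p (absf f)"
  proof (rule ennreal_le_epsilon)
    fix e :: real assume e: "0 < e"
    have "vnorm q (T f) \<le> ennreal (L * (n + e / L))" using e L by (intro le) simp
    also have "\<dots> = ennreal L * vnorm p (absf f) + ennreal e"
      using e L n by (simp add: distrib_left ennreal_mult'[symmetric] ennreal_plus[symmetric] del: ennreal_plus)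
    finally show "vnorm q (T f) \<le> ennreal L * vnorm p (absf f) + ennreal e" .
  qed
qed

text \<open>Since \<open>q = r / \<theta>\<close>, the suitably scaled \<open>q\<close>-integrand of
  \<open>K (M g)^\<theta>\<close> is the \<open>r\<close>-integrand of \<open>M g\<close>, and
  \<open>M\<close> is bounded for \<open>r\<close>. The function \<open>g\<close> may depend on
  \<open>f\<close> in a nonlinear way. The lemma serves both \<open>T = HLmax\<close>, to enlarge
  exponents, and the commutator.\<close>

lemma bounded_var_if_HLmax_dominated:
  fixes r p q :: "'a::euclidean_space \<Rightarrow> real"
  assumes r: "Bvar r" and \<theta>: "0 < \<theta>" and q: "AE x in lebesgue. q x = r x / \<theta>"
    and K: "0 < K" and p: "AE x in lebesgue. 0 \<le> p x"
    and dom: "\<And>f. f \<in> borel_measurable lebesgue \<Longrightarrow> vmodular p (absf f) \<le> 1 \<Longrightarrow>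
       \<exists>g. g \<in> borel_measurable lebesgue \<and> vmodular r (absf g) \<le> 1 \<and>
         (AE x in lebesgue. \<forall>m>0. HLmax g x \<le> ennreal m \<longrightarrow> T f x \<le> ennreal (K * m powr \<theta>))"
    and hom: "\<And>f t x. f \<in> borel_measurable lebesgue \<Longrightarrow> 0 < t \<Longrightarrow> T f x \<le> ennreal t * T (\<lambda>y. f y / t) x"
  shows "bounded_var T p q"
proof -
  obtain C where C: "0 < C" and CM: "\<And>g. g \<in> borel_measurable lebesgue \<Longrightarrow> vmodular r (absf g) \<le> 1 \<Longrightarrow>
       vmodular r (\<lambda>x. HLmax g x / ennreal C) \<le> 1"
    using Bvar_HLmax_modular[OF r] by metis
  have r0: "0 < r x" for x using Pvar_ge_1[OF Bvar_imp_Pvar[OF r], of x] by simp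
  show ?thesis
  proof (rule bounded_varI[OF _ p])
    show "0 < K * C powr \<theta>" using K C by simp
    show "AE x in lebesgue. 0 \<le> q x"
      using q by eventually_elim (use r0 \<theta> in \<open>simp add: less_imp_le\<close>)
  next
    fix f :: "'a \<Rightarrow> real" assume "f \<in> borel_measurable lebesgue" "vmodular p (absf f) \<le> 1"
    then obtain g where g: "g \<in> borel_measurable lebesgue" "vmodular r (absf g) \<le> 1"
      and gT: "AE x in lebesgue. \<forall>m>0. HLmax g x \<le> ennreal m \<longrightarrow> T f x \<le> ennreal (K * m powr \<theta>)"
      using dom by blast
    have "vmodular q (\<lambda>x. T f x / ennreal (K * C powr \<theta>)) \<le> vmodular r (\<lambda>x. HLmax g x / ennreal C)"
      unfolding vmodular_epowr
    proof (rule nn_integral_mono_AE)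
      show "AE x in lebesgue. epowr (T f x / ennreal (K * C powr \<theta>)) (q x) \<le> epowr (HLmax g x / ennreal C) (r x)"
        using gT q
      proof eventually_elim
        case (elim x)
        show ?case unfolding elim(2)
          using elim(1) by (intro epowr_divide_le C \<theta> K r0) auto
      qed
    qed
    also have "\<dots> \<le> 1" by (rule CM[OF g])
    finally show "vmodular q (\<lambda>x. T f x / ennreal (K * C powr \<theta>)) \<le> 1" .
  qed (rule hom)
qed

section \<open>The maximal theorem for the exponent 2\<close>

lemma cubeE:
  assumes "cube Q"
  obtains a l where "0 < l" "Q = cbox a (a + l *\<^sub>R One)"
  using assms by (auto simp: cube_def)

lemma measure_cbox_One:
  fixes a :: "'a::euclidean_space"
  shows "0 \<le> l \<Longrightarrow> measure lborel (cbox a (a + l *\<^sub>R One)) = l ^ DIM('a)"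
  by (subst content_cbox) (auto simp: inner_simps)

lemma emeasure_cbox_One:
  fixes a :: "'a::euclidean_space"
  shows "0 \<le> l \<Longrightarrow> emeasure lborel (cbox a (a + l *\<^sub>R One)) = ennreal (l ^ DIM('a))"
  using measure_cbox_One[of l a] by (subst emeasure_eq_ennreal_measure) (auto simp: emeasure_lborel_cbox_eq)

lemma mem_cbox_One:
  "x \<in> cbox a (a + l *\<^sub>R One) \<longleftrightarrow> (\<forall>i\<in>Basis. a \<bullet> i \<le> x \<bullet> i \<and> x \<bullet> i \<le> a \<bullet> i + l)"
  by (simp add: mem_box inner_simps)

lemma cbox_One_subset:
  assumes "\<And>i. i \<in> Basis \<Longrightarrow> a' \<bullet> i \<le> a \<bullet> i" "\<And>i. i \<in> Basis \<Longrightarrow> a \<bullet> i + l \<le> a' \<bullet> i + l'"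
  shows "cbox a (a + l *\<^sub>R One) \<subseteq> cbox a' (a' + l' *\<^sub>R One)"
  unfolding subset_iff mem_cbox_One using assms by (meson order_trans)

lemma dist_le_if_mem_cbox_One:
  fixes a :: "'a::euclidean_space"
  assumes "x \<in> cbox a (a + l *\<^sub>R One)" "y \<in> cbox a (a + l *\<^sub>R One)"
  shows "dist x y \<le> real DIM('a) * l"
proof -
  have "dist x y \<le> (\<Sum>i\<in>Basis. \<bar>(x - y) \<bullet> i\<bar>)" unfolding dist_norm by (rule norm_le_l1)
  also have "\<dots> \<le> (\<Sum>i\<in>(Basis::'a set). l)"
  proof (rule sum_mono)
    fix i :: 'a assume "i \<in> Basis"
    then have "a \<bullet> i \<le> x \<bullet> i" "x \<bullet> i \<le> a \<bullet> i + l" "a \<bullet> i \<le> y \<bullet> i" "y \<bullet> i \<le> a \<bullet> i + l"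
      using assms by (auto simp: mem_cbox_One)
    then show "\<bar>(x - y) \<bullet> i\<bar> \<le> l" by (simp add: inner_diff_left abs_le_iff)
  qed
  finally show ?thesis by simp
qed

lemma HLmax_upper:
  "cube Q \<Longrightarrow> x \<in> Q \<Longrightarrow>
    ennreal (1 / measure lebesgue Q) * (\<integral>\<^sup>+ y. ennreal \<bar>f y\<bar> * indicator Q y \<partial>lebesgue) \<le> HLmax f x"
  unfolding HLmax_def by (rule SUP_upper) simp

lemma HLmax_le_mult:
  fixes f :: "'a::euclidean_space \<Rightarrow> real"
  assumes [measurable]: "f \<in> borel_measurable lebesgue" and "0 < t"
  shows "HLmax f x \<le> ennreal t * HLmax (\<lambda>y. f y / t) x"
  unfolding HLmax_def[of f]
proof (rule SUP_least, clarsimp)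
  fix Q assume Q: "cube Q" "x \<in> Q"
  then have [measurable]: "Q \<in> sets lebesgue" by (auto elim!: cubeE)
  have "(\<integral>\<^sup>+ y. ennreal \<bar>f y\<bar> * indicator Q y \<partial>lebesgue)
      = (\<integral>\<^sup>+ y. ennreal t * (ennreal \<bar>f y / t\<bar> * indicator Q y) \<partial>lebesgue)"
    using \<open>0 < t\<close> by (intro nn_integral_cong) (simp add: mult.assoc[symmetric] ennreal_mult'[symmetric])
  also have "\<dots> = ennreal t * (\<integral>\<^sup>+ y. ennreal \<bar>f y / t\<bar> * indicator Q y \<partial>lebesgue)"
    by (rule nn_integral_cmult) measurable
  finally have "ennreal (1 / measure lebesgue Q) * (\<integral>\<^sup>+ y. ennreal \<bar>f y\<bar> * indicator Q y \<partial>lebesgue)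
      = ennreal t * (ennreal (1 / measure lebesgue Q) * (\<integral>\<^sup>+ y. ennreal \<bar>f y / t\<bar> * indicator Q y \<partial>lebesgue))"
    by (simp add: mult_ac)
  also have "\<dots> \<le> ennreal t * HLmax (\<lambda>y. f y / t) x"
    by (intro mult_left_mono HLmax_upper Q) simp
  finally show "ennreal (1 / measure lebesgue Q) * (\<integral>\<^sup>+ y. ennreal \<bar>f y\<bar> * indicator Q y \<partial>lebesgue)
    \<le> ennreal t * HLmax (\<lambda>y. f y / t) x" .
qed

text \<open>Cubes are closed, so a point may lie on the boundary of the cube that witnesses a large
  average. A slight enlargement puts it in the interior and lowers the average as little as desired.
  The resulting measurability is what Fubini needs for the exponent 2.\<close>

lemma open_HLmax_greater:
  fixes f :: "'a::euclidean_space \<Rightarrow> real"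
  shows "open {x. c < HLmax f x}"
proof (subst open_subopen, intro ballI, elim CollectE)
  fix x assume "c < HLmax f x"
  then obtain a l where l: "0 < l" and x: "x \<in> cbox a (a + l *\<^sub>R One)"
    and c: "c < ennreal (1 / l ^ DIM('a)) * (\<integral>\<^sup>+ y. ennreal \<bar>f y\<bar> * indicator (cbox a (a + l *\<^sub>R One)) y \<partial>lebesgue)"
    unfolding HLmax_def less_SUP_iff by (auto elim!: cubeE simp: measure_cbox_One)
  define I where "I = (\<integral>\<^sup>+ y. ennreal \<bar>f y\<bar> * indicator (cbox a (a + l *\<^sub>R One)) y \<partial>lebesgue)"
  have "\<exists>e>0. c < ennreal (1 / (l + 2 * e) ^ DIM('a)) * I"
  proof (cases I)
    case top
    have "c < top" using c by (rule less_le_trans) simp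
    then show ?thesis using l top by (intro exI[of _ 1]) (simp add: ennreal_mult_top)
  next
    case (real i)
    have "c < ennreal (1 / l ^ DIM('a) * i)" using c real l by (simp add: I_def[symmetric] ennreal_mult'[symmetric])
    moreover have "((\<lambda>e. ennreal (1 / (l + 2 * e) ^ DIM('a) * i)) \<longlongrightarrow> ennreal (1 / (l + 2 * 0) ^ DIM('a) * i)) (at_right 0)"
      using l by (intro tendsto_intros) auto
    ultimately have "eventually (\<lambda>e. c < ennreal (1 / (l + 2 * e) ^ DIM('a) * i)) (at_right 0)"
      by (intro order_tendstoD) auto
    then have "eventually (\<lambda>e. 0 < e \<and> c < ennreal (1 / (l + 2 * e) ^ DIM('a) * i)) (at_right 0)"
      using eventually_at_right_less[of 0] by eventually_elim auto
    then obtain e where "0 < e" "c < ennreal (1 / (l + 2 * e) ^ DIM('a) * i)"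
      using eventually_happens'[OF trivial_limit_at_right_real] by blast
    then show ?thesis using real l by (intro exI[of _ e]) (simp add: ennreal_mult'[symmetric])
  qed
  then obtain e where e: "0 < e" "c < ennreal (1 / (l + 2 * e) ^ DIM('a)) * I" by blast
  define a' where "a' = a - e *\<^sub>R One"
  let ?Q = "cbox a' (a' + (l + 2 * e) *\<^sub>R One)"
  have Q: "cube ?Q" using e l by (auto simp: cube_def intro!: exI[of _ a'] exI[of _ "l + 2 * e"])
  have sub: "cbox a (a + l *\<^sub>R One) \<subseteq> ?Q"
    using e by (intro cbox_One_subset) (auto simp: a'_def inner_simps)
  have "c < HLmax f y" if y: "y \<in> box a' (a' + (l + 2 * e) *\<^sub>R One)" for y
  proof -
    have "c < ennreal (1 / measure lebesgue ?Q) * I" using e l by (simp add: measure_cbox_One)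
    also have "I \<le> (\<integral>\<^sup>+ y. ennreal \<bar>f y\<bar> * indicator ?Q y \<partial>lebesgue)"
      unfolding I_def using sub by (intro nn_integral_mono mult_left_mono) (auto simp: indicator_def)
    also have "ennreal (1 / measure lebesgue ?Q) * \<dots> \<le> HLmax f y"
      using y box_subset_cbox by (intro HLmax_upper Q) blast
    finally show ?thesis by (simp add: mult_left_mono)
  qed
  moreover have "x \<in> box a' (a' + (l + 2 * e) *\<^sub>R One)"
    using x e by (force simp: a'_def mem_box algebra_simps)
  ultimately show "\<exists>T. open T \<and> x \<in> T \<and> T \<subseteq> {x. c < HLmax f x}"
    using open_box by blast
qed

lemma borel_measurable_HLmax [measurable]: "HLmax f \<in> borel_measurable borel"
  by (rule borel_measurableI_greater) (simp add: open_HLmax_greater)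

text \<open>Vitali's lemma and the dyadic subdivision return countable families that may be finite;
  writing the sum as an integral over \<open>count_space\<close> treats both cases alike.\<close>

lemma emeasure_UN_countable_le:
  assumes "countable I" "\<And>i. i \<in> I \<Longrightarrow> X i \<in> sets M"
  shows "emeasure M (\<Union>i\<in>I. X i) \<le> (\<integral>\<^sup>+ i. emeasure M (X i) \<partial>count_space I)"
proof (cases "finite I")
  case True
  then show ?thesis
    using emeasure_subadditive_finite[of I X M] assms by (auto simp: nn_integral_count_space_finite)
next
  case False
  have bij: "bij_betw (from_nat_into I) UNIV I" by (rule bij_betw_from_nat_into[OF assms(1) False])
  have "(\<Union>i\<in>I. X i) = (\<Union>n. X (from_nat_into I n))" using bij by (auto simp: bij_betw_def) (metis rangeE)
  also have "emeasure M \<dots> \<le> (\<Sum>n. emeasure M (X (from_nat_into I n)))"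
    using bij assms by (intro emeasure_subadditive_countably) (auto simp: bij_betw_def)
  also have "\<dots> = (\<integral>\<^sup>+ i. emeasure M (X i) \<partial>count_space I)"
    by (subst nn_integral_count_space_nat[symmetric]) (rule nn_integral_bij_count_space[OF bij])
  finally show ?thesis .
qed

text \<open>With n the dimension, a cube of side l lies in the ball of radius n l about its lower
  corner. Vitali selects disjoint balls whose fivefold enlargements cover; each of these fits in a
  cube of side 10 n l, of measure (10 n)^n l^n.\<close>

lemma HLmax_weak_type:
  fixes f :: "'a::euclidean_space \<Rightarrow> real"
  assumes f[measurable]: "f \<in> borel_measurable lebesgue" and t: "0 < t"
  shows "ennreal t * emeasure lebesgue {x. ennreal t < HLmax f x}
    \<le> ennreal ((10 * DIM('a)) ^ DIM('a)) * (\<integral>\<^sup>+ x. ennreal \<bar>f x\<bar> \<partial>lebesgue)"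
proof (cases "\<integral>\<^sup>+ x. ennreal \<bar>f x\<bar> \<partial>lebesgue")
  case top
  then show ?thesis by (simp add: ennreal_mult_top)
next
  case (real j)
  define n where "n = DIM('a)"
  have n: "1 \<le> n" unfolding n_def by (simp add: Suc_leI)
  define Q where "Q = (\<lambda>(a::'a, l). cbox a (a + l *\<^sub>R One))"
  define \<nu> where "\<nu> = density lebesgue (\<lambda>x. ennreal \<bar>f x\<bar>)"
  have \<nu>: "emeasure \<nu> A = (\<integral>\<^sup>+ y. ennreal \<bar>f y\<bar> * indicator A y \<partial>lebesgue)" if "A \<in> sets lebesgue" for A
    unfolding \<nu>_def using that by (intro emeasure_density) auto
  have \<nu>_le: "emeasure \<nu> A \<le> ennreal j" if "A \<in> sets lebesgue" for A
    unfolding \<nu>[OF that] real(2)[symmetric] by (intro nn_integral_mono) (auto simp: indicator_def)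
  \<comment> \<open>The cubes, coded by corner and side, on which |f| has average at least
    \<open>t\<close>.\<close>
  define J where "J = {(a::'a, l). 0 < l \<and> ennreal t * ennreal (l ^ n) \<le> emeasure \<nu> (Q (a, l))}"
  define S where "S = {x. ennreal t < HLmax f x}"
  have Qs: "Q i \<in> sets lebesgue" for i by (auto simp: Q_def split: prod.split)
  have Qball: "Q (a, l) \<subseteq> cball a (real n * l)" if "0 < l" for a l
  proof
    fix x assume x: "x \<in> Q (a, l)"
    moreover have "a \<in> Q (a, l)" using that by (simp add: Q_def mem_cbox_One)
    ultimately show "x \<in> cball a (real n * l)"
      using dist_le_if_mem_cbox_One[of a a l x] by (simp add: Q_def n_def)
  qed
  have "S \<subseteq> (\<Union>i\<in>J. cball (fst i) (real n * snd i))"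
  proof
    fix x assume "x \<in> S"
    then obtain a l where l: "0 < l" and x: "x \<in> Q (a, l)"
      and c: "ennreal t < ennreal (1 / l ^ n) * emeasure \<nu> (Q (a, l))"
      unfolding HLmax_def less_SUP_iff S_def by (auto elim!: cubeE simp: measure_cbox_One n_def Q_def \<nu>)
    have "ennreal t * ennreal (l ^ n) \<le> ennreal (1 / l ^ n) * emeasure \<nu> (Q (a, l)) * ennreal (l ^ n)"
      using c by (intro mult_right_mono) auto
    also have "\<dots> = ennreal (1 / l ^ n * l ^ n) * emeasure \<nu> (Q (a, l))"
      using l by (subst ennreal_mult) (auto simp: mult_ac)
    finally have "(a, l) \<in> J" using l by (simp add: J_def)
    then show "x \<in> (\<Union>i\<in>J. cball (fst i) (real n * snd i))"
      using Qball[OF l] x by force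
  qed
  \<comment> \<open>Vitali's lemma asks for bounded radii. From \<open>t * l ^ n \<le> j\<close> one
    gets \<open>l ^ n \<le> j / t\<close>, and \<open>l \<le> l ^ n\<close> once \<open>l\<close> is
    at least 1; this is where the integral of |f| has to be finite.\<close>
  moreover have "0 < real n * snd i \<and> real n * snd i \<le> real n * max 1 (j / t)" if "i \<in> J" for i
  proof -
    obtain a l where i: "i = (a, l)" by (cases i)
    have l: "0 < l" and "ennreal t * ennreal (l ^ n) \<le> ennreal j"
      using that \<nu>_le[OF Qs, of i] by (auto simp: J_def i)
    then have "t * l ^ n \<le> j" using t real(1) by (simp add: ennreal_mult'[symmetric])
    then have "l ^ n \<le> j / t" using t by (simp add: field_simps)
    moreover have "l \<le> l ^ n" if "1 \<le> l" using self_le_power[OF that] n by simp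
    ultimately have "l \<le> max 1 (j / t)" by linarith
    then show ?thesis using l n i by simp
  qed
  ultimately obtain C where C: "countable C" "C \<subseteq> J"
    and dis: "pairwise (\<lambda>i i'. disjnt (cball (fst i) (real n * snd i)) (cball (fst i') (real n * snd i'))) C"
    and cov: "S \<subseteq> (\<Union>i\<in>C. cball (fst i) (5 * (real n * snd i)))"
    by (rule Vitali_covering_lemma_cballs)
  define Q' where "Q' = (\<lambda>i::'a \<times> real. cbox (fst i - (5 * (real n * snd i)) *\<^sub>R One)
      (fst i - (5 * (real n * snd i)) *\<^sub>R One + (10 * (real n * snd i)) *\<^sub>R One))"
  have sub: "cball a s \<subseteq> cbox (a - s *\<^sub>R One) (a - s *\<^sub>R One + (2 * s) *\<^sub>R One)" for a :: 'a and s
  proof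
    fix x assume "x \<in> cball a s"
    then have "\<bar>(x - a) \<bullet> i\<bar> \<le> s" if "i \<in> Basis" for i
      using Basis_le_norm[OF that, of "x - a"] by (simp add: dist_norm norm_minus_commute)
    then show "x \<in> cbox (a - s *\<^sub>R One) (a - s *\<^sub>R One + (2 * s) *\<^sub>R One)"
      by (auto simp: mem_box abs_le_iff algebra_simps)
  qed
  have SQ': "S \<subseteq> (\<Union>i\<in>C. Q' i)"
  proof
    fix x assume "x \<in> S"
    then obtain i where i: "i \<in> C" "x \<in> cball (fst i) (5 * (real n * snd i))" using cov by auto
    then have "x \<in> Q' i"
      using sub[of "fst i" "5 * (real n * snd i)"] unfolding Q'_def by (auto simp: mult.assoc[symmetric])
    then show "x \<in> (\<Union>i\<in>C. Q' i)" using i by auto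
  qed
  have disQ: "disjoint_family_on Q C"
    unfolding disjoint_family_on_def
  proof (intro ballI impI)
    fix i i' assume ii: "i \<in> C" "i' \<in> C" "i \<noteq> i'"
    then have "cball (fst i) (real n * snd i) \<inter> cball (fst i') (real n * snd i') = {}"
      using dis by (auto simp: pairwise_def disjnt_def)
    moreover have "0 < snd i" "0 < snd i'" using ii C(2) by (auto simp: J_def)
    then have "Q i \<subseteq> cball (fst i) (real n * snd i)" "Q i' \<subseteq> cball (fst i') (real n * snd i')"
      using Qball[of "snd i" "fst i"] Qball[of "snd i'" "fst i'"] by simp_all
    ultimately show "Q i \<inter> Q i' = {}" by blast
  qed
  have "emeasure lebesgue S \<le> emeasure lebesgue (\<Union>i\<in>C. Q' i)"
    using C(1) by (intro emeasure_mono SQ' sets.countable_UN') (auto simp: Q'_def)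
  also have "\<dots> \<le> (\<integral>\<^sup>+ i. emeasure lebesgue (Q' i) \<partial>count_space C)"
    by (rule emeasure_UN_countable_le) (auto simp: C Q'_def)
  also have "\<dots> = (\<integral>\<^sup>+ i. ennreal ((10 * n) ^ n) * ennreal (snd i ^ n) \<partial>count_space C)"
  proof (intro nn_integral_cong)
    fix i assume "i \<in> space (count_space C)"
    then have "0 < snd i" using C(2) by (auto simp: J_def)
    then show "emeasure lebesgue (Q' i) = ennreal ((10 * n) ^ n) * ennreal (snd i ^ n)"
      using emeasure_cbox_One[of "10 * (real n * snd i)" "fst i - (5 * (real n * snd i)) *\<^sub>R One"]
      unfolding Q'_def by (subst ennreal_mult''[symmetric]) (auto simp: n_def power_mult_distrib mult_ac)
  qed
  finally have "ennreal t * emeasure lebesgue S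
      \<le> ennreal t * (\<integral>\<^sup>+ i. ennreal ((10 * n) ^ n) * ennreal (snd i ^ n) \<partial>count_space C)"
    by (intro mult_left_mono) auto
  also have "\<dots> = (\<integral>\<^sup>+ i. ennreal ((10 * n) ^ n) * (ennreal t * ennreal (snd i ^ n)) \<partial>count_space C)"
    by (subst nn_integral_cmult[symmetric]) (auto simp: mult_ac)
  \<comment> \<open>Membership in \<open>J\<close> trades \<open>t * l ^ n\<close> for the mass of
    |f| on the cube; the selected cubes are disjoint, so these masses add up to at most
    \<open>j\<close>.\<close>
  also have "\<dots> \<le> (\<integral>\<^sup>+ i. ennreal ((10 * n) ^ n) * emeasure \<nu> (Q i) \<partial>count_space C)"
    using C(2) by (intro nn_integral_mono mult_left_mono) (auto simp: J_def)
  also have "\<dots> = ennreal ((10 * n) ^ n) * emeasure \<nu> (\<Union>i\<in>C. Q i)"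
    using C Qs by (subst emeasure_UN_countable[OF _ _ disQ]) (auto simp: nn_integral_cmult \<nu>_def)
  also have "\<dots> \<le> ennreal ((10 * n) ^ n) * ennreal j"
    using C Qs by (intro mult_left_mono \<nu>_le sets.countable_UN') auto
  finally show ?thesis unfolding S_def real(2)[symmetric] n_def[symmetric] .
qed

section \<open>From the weak type inequality to exponent 2\<close>

lemma sigma_finite_lebesgue: "sigma_finite_measure (lebesgue :: 'a::euclidean_space measure)"
proof -
  obtain A :: "'a set set" where "countable A" "A \<subseteq> sets lborel" "\<Union>A = space lborel" "\<forall>a\<in>A. emeasure lborel a \<noteq> \<infinity>"
    using lborel.sigma_finite_countable by blast
  then show ?thesis by (intro sigma_finite_measure.intro exI[of _ A]) auto
qed

text \<open>Layer-cake formula for a square: for finite \<open>u\<close> it is the integral of 2 t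
  over (0, u), and for infinite \<open>u\<close> the integral exceeds every square.\<close>

lemma nn_integral_two_times_less:
  fixes u :: ennreal
  shows "(\<integral>\<^sup>+ t. ennreal (2 * t) * (if 0 < t \<and> ennreal t < u then 1 else 0) \<partial>lborel) = u\<^sup>2"
proof -
  have *: "(\<integral>\<^sup>+ t. ennreal (2 * t) * (if 0 < t \<and> ennreal t < ennreal m then 1 else 0) \<partial>lborel) = ennreal (m\<^sup>2)"
    if "0 \<le> m" for m
  proof -
    have "(\<integral>\<^sup>+ t. ennreal (2 * t) * (if 0 < t \<and> ennreal t < ennreal m then 1 else 0) \<partial>lborel)
       = (\<integral>\<^sup>+ t. ennreal (2 * t) * indicator {0..m} t \<partial>lborel)"
    proof (rule nn_integral_cong_AE)
      have "AE t in lborel. t \<noteq> 0 \<and> t \<noteq> m"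
        using AE_lborel_singleton[of 0] AE_lborel_singleton[of m] by eventually_elim auto
      then show "AE t in lborel. ennreal (2 * t) * (if 0 < t \<and> ennreal t < ennreal m then 1 else 0)
          = ennreal (2 * t) * indicator {0..m} t"
        by eventually_elim (auto simp: indicator_def ennreal_less_iff)
    qed
    also have "\<dots> = ennreal (m\<^sup>2 - 0\<^sup>2)"
      using that by (intro nn_integral_FTC_Icc) (auto intro!: derivative_eq_intros)
    finally show ?thesis by simp
  qed
  show ?thesis
  proof (cases u)
    case (real m)
    then show ?thesis using * by (simp add: ennreal_power)
  next
    case top
    define I where "I = (\<integral>\<^sup>+ t. ennreal (2 * t) * (if 0 < t \<and> ennreal t < u then 1 else 0) \<partial>lborel)"
    have ge: "ennreal (m\<^sup>2) \<le> I" if "0 \<le> m" for m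
      unfolding I_def *[OF that, symmetric] by (intro nn_integral_mono mult_left_mono) (auto simp: top)
    have "I = top"
    proof (cases I)
      case (real k)
      then have "(k + 1)\<^sup>2 \<le> k" using ge[of "k + 1"] by simp
      moreover have "k < (k + 1)\<^sup>2" using real by (simp add: power2_eq_square algebra_simps add_pos_nonneg)
      ultimately show ?thesis by simp
    qed
    then show ?thesis using top by (simp add: I_def top_power_ennreal)
  qed
qed

text \<open>The part of \<open>f\<close> of height at most \<open>s\<close> contributes at most
  \<open>s\<close> to any average.\<close>

lemma HLmax_le_truncate_add:
  fixes f :: "'a::euclidean_space \<Rightarrow> real"
  assumes [measurable]: "f \<in> borel_measurable lebesgue" and "0 \<le> s"
  shows "HLmax f x \<le> HLmax (\<lambda>y. if s < \<bar>f y\<bar> then f y else 0) x + ennreal s"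
  unfolding HLmax_def[of f]
proof (rule SUP_least, clarsimp)
  fix Q assume Q: "cube Q" "x \<in> Q"
  then obtain a l where l: "0 < l" and Qd: "Q = cbox a (a + l *\<^sub>R One)" by (auto elim!: cubeE)
  have [measurable]: "Q \<in> sets lebesgue" by (simp add: Qd)
  let ?g = "\<lambda>y. if s < \<bar>f y\<bar> then f y else 0"
  have [measurable]: "?g \<in> borel_measurable lebesgue" by measurable
  have "(\<integral>\<^sup>+ y. ennreal \<bar>f y\<bar> * indicator Q y \<partial>lebesgue)
      \<le> (\<integral>\<^sup>+ y. ennreal \<bar>?g y\<bar> * indicator Q y + ennreal s * indicator Q y \<partial>lebesgue)"
    using \<open>0 \<le> s\<close> by (intro nn_integral_mono) (auto simp: indicator_def)
  also have "\<dots> = (\<integral>\<^sup>+ y. ennreal \<bar>?g y\<bar> * indicator Q y \<partial>lebesgue) + (\<integral>\<^sup>+ y. ennreal s * indicator Q y \<partial>lebesgue)"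
    by (rule nn_integral_add) measurable
  also have "(\<integral>\<^sup>+ y. ennreal s * indicator Q y \<partial>lebesgue) = ennreal (s * l ^ DIM('a))"
    using l \<open>0 \<le> s\<close> by (simp add: nn_integral_cmult_indicator Qd emeasure_cbox_One ennreal_mult' [symmetric])
  finally have "ennreal (1 / measure lebesgue Q) * (\<integral>\<^sup>+ y. ennreal \<bar>f y\<bar> * indicator Q y \<partial>lebesgue)
     \<le> ennreal (1 / measure lebesgue Q) * ((\<integral>\<^sup>+ y. ennreal \<bar>?g y\<bar> * indicator Q y \<partial>lebesgue) + ennreal (s * l ^ DIM('a)))"
    by (intro mult_left_mono) auto
  also have "\<dots> = ennreal (1 / measure lebesgue Q) * (\<integral>\<^sup>+ y. ennreal \<bar>?g y\<bar> * indicator Q y \<partial>lebesgue) + ennreal s"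
    using l \<open>0 \<le> s\<close> by (simp add: distrib_left Qd measure_cbox_One ennreal_mult' [symmetric])
  also have "\<dots> \<le> HLmax ?g x + ennreal s" by (intro add_right_mono HLmax_upper Q)
  finally show "ennreal (1 / measure lebesgue Q) * (\<integral>\<^sup>+ y. ennreal \<bar>f y\<bar> * indicator Q y \<partial>lebesgue)
     \<le> HLmax ?g x + ennreal s" .
qed

text \<open>Marcinkiewicz interpolation between weak type at exponent 1 and boundedness at infinity.
  With K the weak constant, 2 t |{M f > t}| is at most 4 K times the integral of |f| over {2 |f| >
  t}; integrating over t below 2 |f| gives 4 K |f| * 2 |f|, whence the factor 8.\<close>

lemma HLmax_L2:
  fixes f :: "'a::euclidean_space \<Rightarrow> real"
  assumes f[measurable]: "f \<in> borel_measurable lebesgue"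
  shows "(\<integral>\<^sup>+ x. (HLmax f x)\<^sup>2 \<partial>lebesgue)
    \<le> ennreal (8 * (10 * real DIM('a)) ^ DIM('a)) * (\<integral>\<^sup>+ x. (ennreal \<bar>f x\<bar>)\<^sup>2 \<partial>lebesgue)"
proof -
  define K where "K = (10 * real DIM('a)) ^ DIM('a)"
  have K0: "0 \<le> K" by (simp add: K_def)
  interpret L: sigma_finite_measure "lebesgue :: 'a measure" by (rule sigma_finite_lebesgue)
  interpret LP: pair_sigma_finite "lebesgue :: 'a measure" "lborel :: real measure" ..
  have HM[measurable]: "HLmax f \<in> borel_measurable lebesgue"
    by (intro measurable_completion) simp
  have tail: "ennreal (2 * t) * emeasure lebesgue {x. ennreal t < HLmax f x}
      \<le> ennreal (4 * K) * (\<integral>\<^sup>+ x. ennreal \<bar>f x\<bar> * (if t < 2 * \<bar>f x\<bar> then 1 else 0) \<partial>lebesgue)" if t: "0 < t" for t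
  proof -
    \<comment> \<open>The discarded part of height at most t / 2 uses up half of the level t; the
      other half is left to the maximal function of \<open>?g\<close>.\<close>
    let ?g = "\<lambda>y. if t / 2 < \<bar>f y\<bar> then f y else 0"
    have sub: "{x. ennreal t < HLmax f x} \<subseteq> {x. ennreal (t / 2) < HLmax ?g x}"
    proof (intro subsetI CollectI, elim CollectE)
      fix x assume "ennreal t < HLmax f x"
      also have "\<dots> \<le> HLmax ?g x + ennreal (t / 2)" using t by (intro HLmax_le_truncate_add) auto
      finally show "ennreal (t / 2) < HLmax ?g x"
      proof (rule contrapos_pp)
        assume "\<not> ennreal (t / 2) < HLmax ?g x"
        then have "HLmax ?g x + ennreal (t / 2) \<le> ennreal (t / 2) + ennreal (t / 2)"
          by (intro add_right_mono) simp
        also have "\<dots> = ennreal t" using t by (simp add: ennreal_plus[symmetric] del: ennreal_plus)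
        finally show "\<not> ennreal t < HLmax ?g x + ennreal (t / 2)" by simp
      qed
    qed
    have "ennreal (2 * t) * emeasure lebesgue {x. ennreal t < HLmax f x}
        \<le> ennreal (2 * t) * emeasure lebesgue {x. ennreal (t / 2) < HLmax ?g x}"
      by (intro mult_left_mono emeasure_mono[OF sub] lmeasurable_open borel_open[THEN sets_completionI_sets]) (auto simp: open_HLmax_greater)
    also have "\<dots> = ennreal 4 * (ennreal (t / 2) * emeasure lebesgue {x. ennreal (t / 2) < HLmax ?g x})"
      using t by (subst mult.assoc[symmetric], subst ennreal_mult'[symmetric]) auto
    also have "\<dots> \<le> ennreal 4 * (ennreal K * (\<integral>\<^sup>+ x. ennreal \<bar>?g x\<bar> \<partial>lebesgue))"
      unfolding K_def using t HLmax_weak_type[of ?g "t / 2"] by (intro mult_left_mono) auto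
    also have "\<dots> = ennreal (4 * K) * (\<integral>\<^sup>+ x. ennreal \<bar>?g x\<bar> \<partial>lebesgue)"
      using K0 by (simp add: mult.assoc[symmetric] ennreal_mult')
    also have "(\<integral>\<^sup>+ x. ennreal \<bar>?g x\<bar> \<partial>lebesgue) = (\<integral>\<^sup>+ x. ennreal \<bar>f x\<bar> * (if t < 2 * \<bar>f x\<bar> then 1 else 0) \<partial>lebesgue)"
      by (intro nn_integral_cong) auto
    finally show ?thesis .
  qed
  have "(\<integral>\<^sup>+ x. (HLmax f x)\<^sup>2 \<partial>lebesgue)
      = (\<integral>\<^sup>+ x. \<integral>\<^sup>+ t. ennreal (2 * t) * (if 0 < t \<and> ennreal t < HLmax f x then 1 else 0) \<partial>lborel \<partial>lebesgue)"
    by (simp add: nn_integral_two_times_less)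
  also have "\<dots> = (\<integral>\<^sup>+ t. \<integral>\<^sup>+ x. ennreal (2 * t) * (if 0 < t \<and> ennreal t < HLmax f x then 1 else 0) \<partial>lebesgue \<partial>lborel)"
    by (rule LP.Fubini'[symmetric]) measurable
  also have "\<dots> \<le> (\<integral>\<^sup>+ t. \<integral>\<^sup>+ x. ennreal (4 * K) * (ennreal \<bar>f x\<bar> * (if 0 < t \<and> t < 2 * \<bar>f x\<bar> then 1 else 0)) \<partial>lebesgue \<partial>lborel)"
  proof (rule nn_integral_mono)
    fix t :: real
    show "(\<integral>\<^sup>+ x. ennreal (2 * t) * (if 0 < t \<and> ennreal t < HLmax f x then 1 else 0) \<partial>lebesgue)
      \<le> (\<integral>\<^sup>+ x. ennreal (4 * K) * (ennreal \<bar>f x\<bar> * (if 0 < t \<and> t < 2 * \<bar>f x\<bar> then 1 else 0)) \<partial>lebesgue)"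
    proof (cases "0 < t")
      case True
      have "(\<integral>\<^sup>+ x. ennreal (2 * t) * (if 0 < t \<and> ennreal t < HLmax f x then 1 else 0) \<partial>lebesgue)
         = (\<integral>\<^sup>+ x. ennreal (2 * t) * indicator {x. ennreal t < HLmax f x} x \<partial>lebesgue)"
        using True by (intro nn_integral_cong) (auto simp: indicator_def)
      also have "\<dots> = ennreal (2 * t) * emeasure lebesgue {x. ennreal t < HLmax f x}"
        by (intro nn_integral_cmult_indicator borel_open[THEN sets_completionI_sets]) (auto simp: open_HLmax_greater)
      also note tail[OF True]
      also have "ennreal (4 * K) * (\<integral>\<^sup>+ x. ennreal \<bar>f x\<bar> * (if t < 2 * \<bar>f x\<bar> then 1 else 0) \<partial>lebesgue)
        = (\<integral>\<^sup>+ x. ennreal (4 * K) * (ennreal \<bar>f x\<bar> * (if 0 < t \<and> t < 2 * \<bar>f x\<bar> then 1 else 0)) \<partial>lebesgue)"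
        using True by (subst nn_integral_cmult) auto
      finally show ?thesis .
    qed simp
  qed
  also have "\<dots> = (\<integral>\<^sup>+ x. \<integral>\<^sup>+ t. ennreal (4 * K) * (ennreal \<bar>f x\<bar> * (if 0 < t \<and> t < 2 * \<bar>f x\<bar> then 1 else 0)) \<partial>lborel \<partial>lebesgue)"
    by (rule LP.Fubini') measurable
  also have "\<dots> = (\<integral>\<^sup>+ x. ennreal (8 * K) * (ennreal \<bar>f x\<bar>)\<^sup>2 \<partial>lebesgue)"
  proof (rule nn_integral_cong)
    fix x
    have "(\<integral>\<^sup>+ t. ennreal (4 * K) * (ennreal \<bar>f x\<bar> * (if 0 < t \<and> t < 2 * \<bar>f x\<bar> then 1 else 0)) \<partial>lborel)
       = (\<integral>\<^sup>+ t. ennreal (4 * K * \<bar>f x\<bar>) * indicator {0<..<2 * \<bar>f x\<bar>} t \<partial>lborel)"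
      using K0 by (intro nn_integral_cong) (auto simp: indicator_def ennreal_mult'')
    also have "\<dots> = ennreal (4 * K * \<bar>f x\<bar> * (2 * \<bar>f x\<bar>))"
      by (subst nn_integral_cmult_indicator, simp, subst emeasure_lborel_Ioo, simp, subst ennreal_mult''[symmetric]) simp_all
    also have "\<dots> = ennreal (8 * K) * (ennreal \<bar>f x\<bar>)\<^sup>2"
    proof -
      have "4 * K * \<bar>f x\<bar> * (2 * \<bar>f x\<bar>) = 8 * K * \<bar>f x\<bar>\<^sup>2" by (simp add: power2_eq_square)
      moreover have "ennreal (8 * K * \<bar>f x\<bar>\<^sup>2) = ennreal (8 * K) * (ennreal \<bar>f x\<bar>)\<^sup>2"
        using K0 by (subst ennreal_mult) (auto simp: ennreal_power simp del: power2_abs)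
      ultimately show ?thesis by (simp only:)
    qed
    finally show "(\<integral>\<^sup>+ t. ennreal (4 * K) * (ennreal \<bar>f x\<bar> * (if 0 < t \<and> t < 2 * \<bar>f x\<bar> then 1 else 0)) \<partial>lborel)
       = ennreal (8 * K) * (ennreal \<bar>f x\<bar>)\<^sup>2" .
  qed
  also have "\<dots> = ennreal (8 * K) * (\<integral>\<^sup>+ x. (ennreal \<bar>f x\<bar>)\<^sup>2 \<partial>lebesgue)"
    by (rule nn_integral_cmult) measurable
  finally show ?thesis unfolding K_def .
qed

section \<open>Campanato's theorem\<close>

lemma locally_integrable_cbox: "locally_integrable b \<Longrightarrow> set_integrable lebesgue (cbox u v) b"
  by (simp add: locally_integrable_def)

text \<open>The average minus \<open>c\<close> is the average of \<open>b - c\<close>. With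
  \<open>c\<close> free, the estimate compares an average both with the average over a larger cube
  and with a single value of \<open>b\<close>.\<close>

lemma abs_avg_diff_le:
  assumes "set_integrable lebesgue Q b" "Q \<in> lmeasurable" "0 < measure lebesgue Q"
  shows "ennreal (\<bar>avg b Q - c\<bar> * measure lebesgue Q) \<le> (\<integral>\<^sup>+ y. ennreal \<bar>b y - c\<bar> * indicator Q y \<partial>lebesgue)"
proof -
  have c: "set_integrable lebesgue Q (\<lambda>y. c)"
    using assms(2) by (auto simp: set_integrable_def fmeasurable_def)
  have int: "set_integrable lebesgue Q (\<lambda>y. b y - c)"
    by (intro set_integral_diff assms c)
  have "(LINT y:Q|lebesgue. b y - c) = (LINT y:Q|lebesgue. b y) - c * measure lebesgue Q"
    using assms(2) by (subst set_integral_diff(2)[OF assms(1) c]) (simp add: set_lebesgue_integral_def fmeasurable_def mult.commute)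
  then have "(avg b Q - c) * measure lebesgue Q = (LINT y:Q|lebesgue. b y - c)"
    using assms(3) by (simp add: avg_def left_diff_distrib)
  then have "\<bar>avg b Q - c\<bar> * measure lebesgue Q = norm (LINT y:Q|lebesgue. b y - c)"
    using assms(3) by (metis abs_mult abs_of_pos real_norm_def)
  also have "ennreal \<dots> \<le> (\<integral>\<^sup>+ y. ennreal (norm (indicator Q y *\<^sub>R (b y - c))) \<partial>lebesgue)"
    unfolding set_lebesgue_integral_def
    by (rule integral_norm_bound_ennreal) (use int in \<open>simp add: set_integrable_def\<close>)
  also have "\<dots> = (\<integral>\<^sup>+ y. ennreal \<bar>b y - c\<bar> * indicator Q y \<partial>lebesgue)"
    by (intro nn_integral_cong) (auto simp: indicator_def)
  finally show ?thesis .
qed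

lemma emeasure_box_One:
  fixes a :: "'a::euclidean_space"
  shows "0 \<le> l \<Longrightarrow> emeasure lborel (box a (a + l *\<^sub>R One)) = ennreal (l ^ DIM('a))"
  by (subst emeasure_lborel_box) (auto simp: inner_simps)

text \<open>\<open>b\<close> is the pointwise limit of its restrictions to the balls of radius n
  about 0.\<close>

lemma borel_measurable_locally_integrable:
  assumes "locally_integrable b"
  shows "b \<in> borel_measurable lebesgue"
proof (rule borel_measurable_LIMSEQ_real)
  fix x :: 'a
  obtain N :: nat where N: "norm x \<le> real N" using real_arch_simple by blast
  have "eventually (\<lambda>n. b x = indicator (cball 0 (real n)) x *\<^sub>R b x) sequentially"
    using eventually_ge_at_top[of N]
    by eventually_elim (use N in \<open>auto simp: indicator_def\<close>)
  then show "(\<lambda>n. indicator (cball 0 (real n)) x *\<^sub>R b x) \<longlonglongrightarrow> b x"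
    by (rule tendsto_eventually[OF eventually_mono]) auto
next
  fix n :: nat
  have "set_integrable lebesgue (cball 0 (real n)) b"
    using assms by (simp add: locally_integrable_def)
  then show "(\<lambda>x. indicator (cball 0 (real n)) x *\<^sub>R b x) \<in> borel_measurable lebesgue"
    by (simp add: set_integrable_def borel_measurable_integrable)
qed

text \<open>The integral is additive over subdivisions, but the bound has order of decay n +
  \<beta>, larger than n: cutting a cube into pieces of side at most 2 \<epsilon> bounds the
  integral by D (2 \<epsilon>)^\<beta> times the volume, which tends to 0.\<close>

lemma nn_integral_cbox_eq_0:
  fixes h :: "'a::euclidean_space \<Rightarrow> ennreal"
  assumes h: "h \<in> borel_measurable lebesgue" and \<beta>: "0 < \<beta>" and D: "0 \<le> D" and l: "0 < l"
    and cubes: "\<And>a l. 0 < l \<Longrightarrow>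
      (\<integral>\<^sup>+ y. h y * indicator (cbox a (a + l *\<^sub>R One)) y \<partial>lebesgue) \<le> ennreal (D * l powr \<beta> * l ^ DIM('a))"
  shows "(\<integral>\<^sup>+ y. h y * indicator (cbox a (a + l *\<^sub>R One)) y \<partial>lebesgue) = 0"
proof -
  define \<nu> where "\<nu> = density lebesgue h"
  have \<nu>: "emeasure \<nu> A = (\<integral>\<^sup>+ y. h y * indicator A y \<partial>lebesgue)" if "A \<in> sets lebesgue" for A
    unfolding \<nu>_def using that h by (intro emeasure_density) auto
  let ?Q = "cbox a (a + l *\<^sub>R One)"
  have small: "emeasure \<nu> ?Q \<le> ennreal (D * (2 * \<epsilon>) powr \<beta> * l ^ DIM('a))" if \<epsilon>: "0 < \<epsilon>" for \<epsilon>
  proof -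
    have ne: "box a (a + l *\<^sub>R One) \<noteq> {}" using l by (auto simp: box_ne_empty inner_simps)
    \<comment> \<open>The gauge of balls of radius \<open>\<epsilon>\<close> forces the pieces to be
      small; the clause on edge lengths shows that each piece is again a cube, so that
      \<open>cubes\<close> applies to it.\<close>
    obtain \<D> where \<D>: "countable \<D>" "\<Union>\<D> \<subseteq> ?Q"
      "\<And>K. K \<in> \<D> \<Longrightarrow> interior K \<noteq> {} \<and> (\<exists>c d. K = cbox c d)"
      "pairwise (\<lambda>A B. interior A \<inter> interior B = {}) \<D>"
      "\<And>K. K \<in> \<D> \<Longrightarrow> \<exists>x \<in> ?Q \<inter> K. K \<subseteq> ball x \<epsilon>"
      "\<And>u v. cbox u v \<in> \<D> \<Longrightarrow> \<exists>n. \<forall>i \<in> Basis. v \<bullet> i - u \<bullet> i = ((a + l *\<^sub>R One) \<bullet> i - a \<bullet> i) / 2^n"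
      "?Q \<subseteq> \<Union>\<D>"
    proof (rule covering_lemma[OF order_refl ne gauge_ball[OF \<epsilon>]], goal_cases)
      case (1 \<D>)
      show ?thesis by (rule that) (fact 1)+
    qed
    have K: "K \<in> sets lebesgue \<and> interior K \<in> sets lebesgue \<and>
        emeasure \<nu> K \<le> ennreal (D * (2 * \<epsilon>) powr \<beta>) * emeasure lebesgue (interior K)" if "K \<in> \<D>" for K
    proof -
      obtain c d where Kcd: "K = cbox c d" using \<D>(3) \<open>K \<in> \<D>\<close> by blast
      then obtain m where m: "\<And>i. i \<in> Basis \<Longrightarrow> d \<bullet> i - c \<bullet> i = l / 2 ^ m"
        using \<D>(6)[of c d] \<open>K \<in> \<D>\<close> by (auto simp: inner_simps)
      define s where "s = l / 2 ^ m"
      have s: "0 < s" using l by (simp add: s_def)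
      have d: "d = c + s *\<^sub>R One"
      proof (rule euclidean_eqI)
        fix i :: 'a assume "i \<in> Basis"
        then show "d \<bullet> i = (c + s *\<^sub>R One) \<bullet> i" using m[of i] by (simp add: inner_simps s_def)
      qed
      obtain x where x: "K \<subseteq> ball x \<epsilon>" using \<D>(5)[OF \<open>K \<in> \<D>\<close>] by blast
      obtain i :: 'a where i: "i \<in> Basis" using nonempty_Basis by blast
      have "c \<in> K" "c + s *\<^sub>R i \<in> K"
        using s i by (auto simp: Kcd d mem_box inner_simps inner_Basis)
      then have "dist c x < \<epsilon>" "dist (c + s *\<^sub>R i) x < \<epsilon>" using x by (auto simp: dist_commute)
      then have "dist c (c + s *\<^sub>R i) < 2 * \<epsilon>" using dist_triangle2[of c "c + s *\<^sub>R i" x] by linarith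
      then have "s \<le> 2 * \<epsilon>" using i s by (simp add: dist_norm)
      have int: "interior K = box c (c + s *\<^sub>R One)" by (simp add: Kcd d)
      have "emeasure \<nu> K \<le> ennreal (D * s powr \<beta> * s ^ DIM('a))"
        unfolding Kcd d using cubes[OF s, of c] by (subst \<nu>) auto
      also have "\<dots> \<le> ennreal (D * (2 * \<epsilon>) powr \<beta> * s ^ DIM('a))"
        using \<open>s \<le> 2 * \<epsilon>\<close> s D \<beta> by (intro ennreal_leI mult_right_mono mult_left_mono powr_mono2) auto
      also have "\<dots> = ennreal (D * (2 * \<epsilon>) powr \<beta>) * emeasure lebesgue (interior K)"
        using s D by (simp add: int emeasure_box_One ennreal_mult')
      finally show ?thesis by (simp add: int Kcd)
    qed
    have "emeasure \<nu> ?Q \<le> emeasure \<nu> (\<Union>K\<in>\<D>. K)"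
      using \<D> K by (intro emeasure_mono) (auto simp: \<nu>_def intro!: sets.countable_Union)
    also have "\<dots> \<le> (\<integral>\<^sup>+ K. emeasure \<nu> K \<partial>count_space \<D>)"
      using K by (intro emeasure_UN_countable_le \<D>) (auto simp: \<nu>_def)
    also have "\<dots> \<le> (\<integral>\<^sup>+ K. ennreal (D * (2 * \<epsilon>) powr \<beta>) * emeasure lebesgue (interior K) \<partial>count_space \<D>)"
      using K by (intro nn_integral_mono) auto
    \<comment> \<open>The closed pieces may share faces and only their interiors are disjoint; hence
      the bound for each piece was stated with the measure of its interior.\<close>
    also have "\<dots> = ennreal (D * (2 * \<epsilon>) powr \<beta>) * emeasure lebesgue (\<Union>K\<in>\<D>. interior K)"
      using K \<D>(4) by (subst emeasure_UN_countable)
        (auto simp: nn_integral_cmult disjoint_family_on_def pairwise_def \<D>(1))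
    also have "\<dots> \<le> ennreal (D * (2 * \<epsilon>) powr \<beta>) * emeasure lebesgue ?Q"
    proof (intro mult_left_mono emeasure_mono)
      show "(\<Union>K\<in>\<D>. interior K) \<subseteq> ?Q" using \<D>(2) interior_subset by blast
    qed auto
    also have "\<dots> = ennreal (D * (2 * \<epsilon>) powr \<beta> * l ^ DIM('a))"
      using l D by (simp add: emeasure_cbox_One ennreal_mult')
    finally show ?thesis .
  qed
  have "emeasure \<nu> ?Q \<le> 0 + ennreal e" if e: "0 < e" for e
  proof -
    define c where "c = D * l ^ DIM('a)"
    have c: "0 \<le> c" using D l by (simp add: c_def)
    \<comment> \<open>Chosen so that \<open>(2 * \<epsilon>) powr \<beta> = e / (c + 1)\<close>; the
      1 covers \<open>c = 0\<close>.\<close>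
    define \<epsilon> where "\<epsilon> = (e / (c + 1)) powr (1 / \<beta>) / 2"
    have "0 < \<epsilon>" "(2 * \<epsilon>) powr \<beta> = e / (c + 1)"
      using e c \<beta> by (auto simp: \<epsilon>_def powr_powr)
    then have "emeasure \<nu> ?Q \<le> ennreal (e / (c + 1) * c)"
      using small[of \<epsilon>] by (simp add: c_def mult_ac)
    also have "\<dots> \<le> ennreal e"
      using e c by (intro ennreal_leI) (simp add: field_simps)
    finally show ?thesis by simp
  qed
  then have "emeasure \<nu> ?Q = 0" using ennreal_le_epsilon[of 0 "emeasure \<nu> ?Q"] by simp
  then show ?thesis by (subst (asm) \<nu>) auto
qed

lemma AE_lebesgue_if_AE_cubes:
  assumes "\<And>a l. 0 < l \<Longrightarrow> AE x in lebesgue. x \<in> cbox a (a + l *\<^sub>R One) \<longrightarrow> P x"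
  shows "AE x::'a::euclidean_space in lebesgue. P x"
proof -
  \<comment> \<open>Cubes centred at 0 that exhaust the space; \<open>Suc n\<close> keeps the side
    positive at n = 0.\<close>
  let ?Q = "\<lambda>n::nat. cbox (- real (Suc n) *\<^sub>R One) (- real (Suc n) *\<^sub>R One + (2 * real (Suc n)) *\<^sub>R One) :: 'a set"
  have "AE x in lebesgue. \<forall>n. x \<in> ?Q n \<longrightarrow> P x"
    by (subst AE_all_countable) (intro allI assms, simp)
  then show ?thesis
  proof eventually_elim
    case (elim x)
    obtain n :: nat where n: "norm x \<le> real n" using real_arch_simple by blast
    have "\<bar>x \<bullet> i\<bar> \<le> real (Suc n)" if "i \<in> Basis" for i
      using Basis_le_norm[OF that, of x] n by simp
    then have "x \<in> ?Q n" unfolding mem_cbox_One by (force simp: abs_le_iff inner_simps)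
    then show ?case using elim by blast
  qed
qed

text \<open>The averages over the cubes with lower corner \<open>x\<close> and side \<open>l\<close>
  differ from their limit as \<open>l\<close> tends to 0 by at most a multiple of \<open>l powr \<beta>\<close>; the
  supremum defining \<open>b'\<close> below is a way to write this limit.\<close>

lemma Campanato_imp_Lip_hom:
  fixes b :: "'a::euclidean_space \<Rightarrow> real"
  assumes b: "locally_integrable b" and \<beta>: "0 < \<beta>" and K: "0 \<le> K"
    and osc: "\<And>a l. 0 < l \<Longrightarrow> (\<integral>\<^sup>+ y. ennreal \<bar>b y - avg b (cbox a (a + l *\<^sub>R One))\<bar> *
        indicator (cbox a (a + l *\<^sub>R One)) y \<partial>lebesgue) \<le> ennreal (K * l powr \<beta> * l ^ DIM('a))"
  shows "\<exists>b'. (AE x in lebesgue. b x = b' x) \<and> Lip_hom \<beta> b'"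
proof -
  define n where "n = DIM('a)"
  have n: "1 \<le> n" unfolding n_def by (simp add: Suc_leI)
  define Q where "Q = (\<lambda>(a::'a) l. cbox a (a + l *\<^sub>R One))"
  define A where "A = (\<lambda>a l. avg b (Q a l))"
  have mQ: "measure lebesgue (Q a l) = l ^ n" if "0 < l" for a l
    using that by (simp add: Q_def n_def measure_cbox_One)
  \<comment> \<open>The mean deviation on the small cube from the large average is at most the
    oscillation on the large cube, up to the ratio of volumes.\<close>
  have compare: "\<bar>A a l - A a' l'\<bar> \<le> K * l' powr \<beta> * (l' / l) ^ n"
    if "0 < l" "0 < l'" "Q a l \<subseteq> Q a' l'" for a l a' l'
  proof -
    have "ennreal (\<bar>A a l - A a' l'\<bar> * l ^ n) \<le> (\<integral>\<^sup>+ y. ennreal \<bar>b y - A a' l'\<bar> * indicator (Q a l) y \<partial>lebesgue)"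
      using abs_avg_diff_le[of "Q a l" b "A a' l'"] mQ[OF that(1), of a] that(1) locally_integrable_cbox[OF b]
      by (simp add: A_def) (simp add: Q_def)
    also have "\<dots> \<le> (\<integral>\<^sup>+ y. ennreal \<bar>b y - A a' l'\<bar> * indicator (Q a' l') y \<partial>lebesgue)"
      using that(3) by (intro nn_integral_mono mult_left_mono) (auto simp: indicator_def)
    also have "\<dots> \<le> ennreal (K * l' powr \<beta> * l' ^ n)"
      using osc[OF that(2), of a'] by (simp add: A_def Q_def n_def)
    finally have "\<bar>A a l - A a' l'\<bar> * l ^ n \<le> K * l' powr \<beta> * l' ^ n"
      using K that by simp
    then show ?thesis using that by (simp add: field_simps)
  qed
  define \<rho> :: real where "\<rho> = (1/2) powr \<beta>"
  have \<rho>: "0 < \<rho>" "\<rho> < 1"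
    using \<beta> powr_less_mono'[of "1/2" 0 \<beta>] by (auto simp: \<rho>_def)
  \<comment> \<open>Sum of a geometric series: one halving of the side costs
    \<open>K * 2 ^ n * l powr \<beta>\<close>, and the next cost is smaller by the factor
    \<open>\<rho>\<close>. The fixed-point equation for \<open>K2\<close> closes the induction
    below.\<close>
  define K2 where "K2 = K * 2 ^ n / (1 - \<rho>)"
  have K2: "0 \<le> K2" "K2 * \<rho> + K * 2 ^ n = K2" "K * 2 ^ n \<le> K2"
    using \<rho> K mult_left_mono[of "1 - \<rho>" 1 "K * 2 ^ n"] by (auto simp: K2_def field_simps)
  have sub: "Q x l' \<subseteq> Q x l" if "l' \<le> l" for x l' l
    using that unfolding Q_def by (intro cbox_One_subset) auto
  have decay: "\<bar>A x l' - A x l\<bar> \<le> K2 * l powr \<beta>" if "0 < l'" "l' \<le> l" for x l' l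
  proof -
    \<comment> \<open>Induction on the number \<open>k\<close> of halvings that lead from
      \<open>l\<close> down to \<open>l'\<close>; a ratio of sides of at most 2 is settled by a
      single comparison.\<close>
    have "\<bar>A x l' - A x l\<bar> \<le> K2 * l powr \<beta>" if "0 < l'" "l' \<le> l" "l \<le> 2 ^ k * l'" for k
      using that
    proof (induction k arbitrary: l)
      case 0
      then have "l' = l" by simp
      then show ?case using K2 by simp
    next
      case (Suc k)
      have half: "\<bar>A x s - A x l\<bar> \<le> K * 2 ^ n * l powr \<beta>" if "l / 2 \<le> s" "s \<le> l" for s
      proof -
        have s: "0 < s" using Suc.prems that by linarith
        have "\<bar>A x s - A x l\<bar> \<le> K * l powr \<beta> * (l / s) ^ n"
          using Suc.prems that s by (intro compare sub) auto
        also have "\<dots> \<le> K * l powr \<beta> * 2 ^ n"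
          using K s that Suc.prems by (intro mult_left_mono power_mono) (auto simp: field_simps)
        finally show ?thesis by (simp add: mult_ac)
      qed
      show ?case
      proof (cases "l / 2 \<le> l'")
        case True
        then have "\<bar>A x l' - A x l\<bar> \<le> K * 2 ^ n * l powr \<beta>" using Suc.prems by (intro half)
        also have "\<dots> \<le> K2 * l powr \<beta>" by (intro mult_right_mono K2) simp
        finally show ?thesis .
      next
        case False
        then have "\<bar>A x l' - A x (l / 2)\<bar> \<le> K2 * (l / 2) powr \<beta>"
          using Suc.prems by (intro Suc.IH) auto
        moreover have "(l / 2) powr \<beta> = \<rho> * l powr \<beta>"
          using Suc.prems by (simp add: \<rho>_def powr_divide)
        moreover have "\<bar>A x (l / 2) - A x l\<bar> \<le> K * 2 ^ n * l powr \<beta>"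
          using Suc.prems by (intro half) auto
        ultimately have "\<bar>A x l' - A x l\<bar> \<le> (K2 * \<rho> + K * 2 ^ n) * l powr \<beta>"
          by (simp add: algebra_simps)
        then show ?thesis using K2 by simp
      qed
    qed
    moreover obtain k where "l / l' < 2 ^ k" using real_arch_pow[of 2 "l / l'"] by auto
    then have "l \<le> 2 ^ k * l'" using that by (simp add: field_simps)
    ultimately show ?thesis using that by blast
  qed
  define b' where "b' = (\<lambda>x. SUP l\<in>{0<..}. A x l - K2 * l powr \<beta>)"
  \<comment> \<open>Each lower bound lies below each upper bound, by \<open>decay\<close> between
    the two sides. So the set in the supremum is bounded above, for instance by the upper bound at
    side 1.\<close>
  have le: "A x l' - K2 * l' powr \<beta> \<le> A x l + K2 * l powr \<beta>" if "0 < l" "0 < l'" for x l l'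
  proof (cases "l \<le> l'")
    case True
    then have "A x l' - K2 * l' powr \<beta> \<le> A x l" using decay[of l l' x] that by (simp add: abs_le_iff)
    then show ?thesis using K2 by (simp add: add_increasing2)
  next
    case False
    then have "A x l' \<le> A x l + K2 * l powr \<beta>" using decay[of l' l x] that by (simp add: abs_le_iff)
    moreover have "0 \<le> K2 * l' powr \<beta>" using K2 by simp
    ultimately show ?thesis by linarith
  qed
  have b'A: "\<bar>b' x - A x l\<bar> \<le> K2 * l powr \<beta>" if l: "0 < l" for x l
  proof -
    have "b' x \<le> A x l + K2 * l powr \<beta>"
      unfolding b'_def by (rule cSUP_least) (use le l in auto)
    moreover have "A x l - K2 * l powr \<beta> \<le> b' x"
      unfolding b'_def
      by (rule cSUP_upper) (use l le[of 1 _ x] in \<open>auto intro!: bdd_aboveI2[where M="A x 1 + K2 * 1 powr \<beta>"]\<close>)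
    ultimately show ?thesis by (simp add: abs_le_iff)
  qed
  \<comment> \<open>Two passages from a value of \<open>b'\<close> to an average at side d = |x -
    y|, and two from there to a common cube of side 3 d.\<close>
  define L where "L = 2 * K2 + 2 * (K * 3 powr \<beta> * 3 ^ n)"
  have L: "0 \<le> L" using K K2 by (simp add: L_def)
  have Lip: "\<bar>b' x - b' y\<bar> \<le> L * dist x y powr \<beta>" for x y
  proof (cases "x = y")
    case False
    define d where "d = dist x y"
    have d: "0 < d" using False by (simp add: d_def)
    let ?R = "\<lambda>z. A (z - d *\<^sub>R One) (3 * d)"
    have coord: "\<bar>x \<bullet> i - y \<bullet> i\<bar> \<le> d" if "i \<in> Basis" for i
      using Basis_le_norm[OF that, of "x - y"] by (simp add: d_def dist_norm inner_simps)
    \<comment> \<open>The coordinates of \<open>x\<close> and \<open>y\<close> differ by at most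
      \<open>d\<close>, so moving the corner of the cube back by \<open>d\<close> and tripling the
      side captures both cubes.\<close>
    have "Q x d \<subseteq> Q (x - d *\<^sub>R One) (3 * d)" "Q y d \<subseteq> Q (x - d *\<^sub>R One) (3 * d)"
      unfolding Q_def using d coord by (intro cbox_One_subset; force simp: inner_simps abs_le_iff)+
    then have R: "\<bar>A x d - ?R x\<bar> \<le> K * (3 * d) powr \<beta> * (3 * d / d) ^ n" "\<bar>A y d - ?R x\<bar> \<le> K * (3 * d) powr \<beta> * (3 * d / d) ^ n"
      using d by (intro compare; simp)+
    have "\<bar>b' x - b' y\<bar> \<le> 2 * (K2 * d powr \<beta>) + 2 * (K * (3 * d) powr \<beta> * (3 * d / d) ^ n)"
      using R b'A[OF d, of x] b'A[OF d, of y] by linarith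
    also have "\<dots> = L * d powr \<beta>" using d by (simp add: L_def powr_mult algebra_simps)
    finally show ?thesis by (simp add: d_def)
  qed simp
  have "continuous_on UNIV b'"
    unfolding continuous_on_def
  proof
    fix x :: 'a
    have "((\<lambda>y. L * dist y x powr \<beta>) \<longlongrightarrow> L * dist x x powr \<beta>) (at x)"
      using \<beta> by (intro tendsto_intros) auto
    then have "((\<lambda>y. L * dist y x powr \<beta>) \<longlongrightarrow> 0) (at x)" using \<beta> by simp
    then have "((\<lambda>y. b' y - b' x) \<longlongrightarrow> 0) (at x)"
      by (rule Lim_null_comparison[rotated]) (use Lip in auto)
    then show "(b' \<longlongrightarrow> b' x) (at x)" by (simp add: LIM_zero_iff)
  qed
  then have [measurable]: "b' \<in> borel_measurable lebesgue"
    by (intro measurable_completion) (simp add: borel_measurable_continuous_onI)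
  have [measurable]: "b \<in> borel_measurable lebesgue" by (rule borel_measurable_locally_integrable[OF b])
  \<comment> \<open>\<open>K\<close> bounds the oscillation of \<open>b\<close>, \<open>K2\<close>
    the distance from the average to \<open>b'\<close> at the corner, and
    \<open>L * n powr \<beta>\<close> the variation of \<open>b'\<close> across the cube.\<close>
  define D where "D = K + (K2 + L * n powr \<beta>)"
  have D: "0 \<le> D" using K K2 L by (simp add: D_def)
  have int: "(\<integral>\<^sup>+ y. ennreal \<bar>b y - b' y\<bar> * indicator (Q a l) y \<partial>lebesgue) \<le> ennreal (D * l powr \<beta> * l ^ n)"
    if l: "0 < l" for a l
  proof -
    define E where "E = (K2 + L * n powr \<beta>) * l powr \<beta>"
    have E: "0 \<le> E" using K2 L by (simp add: E_def)
    have [measurable]: "Q a l \<in> sets lebesgue" by (simp add: Q_def)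
    have pt: "\<bar>b y - b' y\<bar> \<le> \<bar>b y - A a l\<bar> + E" if y: "y \<in> Q a l" for y
    proof -
      have "dist a y \<le> n * l"
        using dist_le_if_mem_cbox_One[of a a l y] y l by (simp add: Q_def n_def mem_cbox_One)
      then have "L * dist a y powr \<beta> \<le> L * (n * l) powr \<beta>"
        using L \<beta> by (intro mult_left_mono powr_mono2) auto
      then have "\<bar>b' a - b' y\<bar> \<le> L * (n powr \<beta> * l powr \<beta>)"
        using Lip[of a y] l by (simp add: powr_mult)
      then show ?thesis using b'A[OF l, of a] by (simp add: E_def algebra_simps)
    qed
    have "(\<integral>\<^sup>+ y. ennreal \<bar>b y - b' y\<bar> * indicator (Q a l) y \<partial>lebesgue)
      \<le> (\<integral>\<^sup>+ y. ennreal \<bar>b y - A a l\<bar> * indicator (Q a l) y + ennreal E * indicator (Q a l) y \<partial>lebesgue)"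
      using pt E by (intro nn_integral_mono) (auto simp: indicator_def ennreal_plus[symmetric] simp del: ennreal_plus)
    also have "\<dots> = (\<integral>\<^sup>+ y. ennreal \<bar>b y - A a l\<bar> * indicator (Q a l) y \<partial>lebesgue) + (\<integral>\<^sup>+ y. ennreal E * indicator (Q a l) y \<partial>lebesgue)"
      by (rule nn_integral_add) measurable
    also have "\<dots> \<le> ennreal (K * l powr \<beta> * l ^ n) + ennreal (E * l ^ n)"
      using osc[OF l, of a] E l
      by (intro add_mono) (auto simp: A_def Q_def n_def nn_integral_cmult_indicator emeasure_cbox_One ennreal_mult')
    also have "\<dots> = ennreal (D * l powr \<beta> * l ^ n)"
    proof -
      have "D * l powr \<beta> * l ^ n = K * l powr \<beta> * l ^ n + E * l ^ n"
        by (simp add: D_def E_def algebra_simps)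
      then show ?thesis using E K l by simp
    qed
    finally show ?thesis .
  qed
  have "AE x in lebesgue. b x = b' x"
  proof (rule AE_lebesgue_if_AE_cubes)
    fix a :: 'a and l :: real assume l: "0 < l"
    have [measurable]: "cbox a (a + l *\<^sub>R One) \<in> sets lebesgue" by simp
    have "(\<integral>\<^sup>+ y. ennreal \<bar>b y - b' y\<bar> * indicator (cbox a (a + l *\<^sub>R One)) y \<partial>lebesgue) = 0"
      by (rule nn_integral_cbox_eq_0[OF _ \<beta> D l]) (use int in \<open>auto simp: Q_def n_def\<close>)
    then have "AE y in lebesgue. ennreal \<bar>b y - b' y\<bar> * indicator (cbox a (a + l *\<^sub>R One)) y = 0"
      by (subst (asm) nn_integral_0_iff_AE) measurable
    then show "AE y in lebesgue. y \<in> cbox a (a + l *\<^sub>R One) \<longrightarrow> b y = b' y"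
      by eventually_elim (auto simp: indicator_def)
  qed
  then show ?thesis using Lip unfolding Lip_hom_def by blast
qed

section \<open>Norms of characteristic functions and admissible exponents\<close>

lemma powr_side: "0 < l \<Longrightarrow> (l ^ DIM('a::euclidean_space)) powr (c / real DIM('a)) = l powr c" for l c :: real
  by (simp add: powr_realpow[symmetric] powr_powr)

lemma vmodular_indicator_divide:
  assumes "0 < t"
  shows "vmodular s (\<lambda>x. absf (indicator A) x / ennreal t)
    = (\<integral>\<^sup>+ x. ennreal ((1 / t) powr s x) * indicator A x \<partial>lebesgue)"
  unfolding vmodular_epowr absf_def
proof (rule nn_integral_cong)
  fix x
  show "epowr (ennreal \<bar>indicator A x\<bar> / ennreal t) (s x) = ennreal ((1 / t) powr s x) * indicator A x"
    using assms divide_ennreal[of 1 t] epowr_ennreal[of "1 / t"] by (cases "x \<in> A") auto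
qed

text \<open>Allows norms of characteristic functions to be cancelled. A scaling on either side of 1
  reduces all exponents, being at least 1, to the exponent 1.\<close>

lemma vnorm_indicator_cube:
  fixes s :: "'a::euclidean_space \<Rightarrow> real"
  assumes s: "\<And>x. 1 \<le> s x" and l: "0 < l"
  shows "0 < vnorm s (absf (indicator (cbox a (a + l *\<^sub>R One))))"
    and "vnorm s (absf (indicator (cbox a (a + l *\<^sub>R One)))) < \<infinity>"
proof -
  let ?Q = "cbox a (a + l *\<^sub>R One)"
  have const: "(\<integral>\<^sup>+ x. ennreal (1 / t) * indicator ?Q x \<partial>lebesgue) = ennreal (l ^ DIM('a) / t)" if "0 < t" for t
    using l that by (simp add: nn_integral_cmult_indicator emeasure_cbox_One ennreal_mult''[symmetric])
  \<comment> \<open>For \<open>t \<ge> 1\<close> the integrand is at most \<open>1 / t\<close>, so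
    the modular is at most \<open>l^n / t\<close>.\<close>
  define t where "t = max 1 (l ^ DIM('a))"
  have t: "1 \<le> t" "l ^ DIM('a) \<le> t" by (auto simp: t_def)
  have "vmodular s (\<lambda>x. absf (indicator ?Q) x / ennreal t) \<le> (\<integral>\<^sup>+ x. ennreal (1 / t) * indicator ?Q x \<partial>lebesgue)"
    using t s powr_mono'[of 1 _ "1 / t"] by (subst vmodular_indicator_divide) (auto intro!: nn_integral_mono mult_right_mono ennreal_leI)
  also have "\<dots> \<le> 1" using t l by (subst const) (auto simp: divide_le_eq_1 simp flip: ennreal_1)
  finally have "vnorm s (absf (indicator ?Q)) \<le> ennreal t" using t by (intro vnorm_le) auto
  then show "vnorm s (absf (indicator ?Q)) < \<infinity>" by (auto intro: le_less_trans)
  \<comment> \<open>For \<open>u \<le> 1\<close> the integrand is at least \<open>1 / u\<close>;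
    halving makes \<open>l^n / u\<close> exceed 1.\<close>
  define u where "u = min 1 (l ^ DIM('a)) / 2"
  have u: "0 < u" "u \<le> 1" "u < l ^ DIM('a)" using l by (auto simp: u_def min_def)
  have "\<not> vnorm s (absf (indicator ?Q)) < ennreal u"
  proof
    assume "vnorm s (absf (indicator ?Q)) < ennreal u"
    moreover have "AE x in lebesgue. 0 \<le> s x" using s by (intro AE_I2) (meson order_trans zero_le_one)
    ultimately have "vmodular s (\<lambda>x. absf (indicator ?Q) x / ennreal u) \<le> 1"
      by (rule vmodular_le_1_if_vnorm_less)
    moreover have "(\<integral>\<^sup>+ x. ennreal (1 / u) * indicator ?Q x \<partial>lebesgue) \<le> vmodular s (\<lambda>x. absf (indicator ?Q) x / ennreal u)"
      using u s powr_mono[of 1 _ "1 / u"] by (subst vmodular_indicator_divide) (auto intro!: nn_integral_mono mult_right_mono ennreal_leI)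
    ultimately have "ennreal (l ^ DIM('a) / u) \<le> 1" unfolding const[OF u(1)] by (rule order_trans[rotated])
    then have "l ^ DIM('a) / u \<le> 1" by simp
    then show False using u by (simp add: divide_le_eq_1)
  qed
  moreover have "0 < ennreal u" using u by simp
  ultimately show "0 < vnorm s (absf (indicator ?Q))" by order
qed

text \<open>The bounds on \<open>N\<close> keep away the conventional values of division by 0 or
  infinity.\<close>

lemma ennreal_ratio_le_iff:
  assumes "0 < c" "0 < N" "N < \<infinity>" "0 \<le> K"
  shows "ennreal (1 / c) * V / N \<le> ennreal K \<longleftrightarrow> V \<le> ennreal (K * c) * N"
proof -
  obtain \<nu> where \<nu>: "0 < \<nu>" "N = ennreal \<nu>" using assms by (cases N) auto
  show ?thesis
  proof (cases V)
    case (real v)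
    then have "ennreal (1 / c) * V / N = ennreal (v / (c * \<nu>))" "ennreal (K * c) * N = ennreal (K * c * \<nu>)"
      using \<nu> assms by (simp_all add: divide_ennreal flip: ennreal_mult')
    then show ?thesis using real \<nu> assms by (simp add: field_simps)
  next
    case top
    then show ?thesis
      using \<nu> assms by (simp add: ennreal_mult_top ennreal_top_divide top_unique flip: ennreal_mult')
  qed
qed

lemma osc_sup_le_iff:
  fixes s :: "'a::euclidean_space \<Rightarrow> real"
  assumes s: "Pvar s" and K: "0 \<le> K"
  shows "osc_sup \<beta> s b \<le> ennreal K \<longleftrightarrow>
    (\<forall>a l. 0 < l \<longrightarrow>
       vnorm s (absf (\<lambda>x. (b x - avg b (cbox a (a + l *\<^sub>R One))) * indicator (cbox a (a + l *\<^sub>R One)) x))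
       \<le> ennreal (K * l powr \<beta>) * vnorm s (absf (indicator (cbox a (a + l *\<^sub>R One)))))"
proof -
  have "ennreal (1 / measure lebesgue Q powr (\<beta> / real DIM('a))) * V / vnorm s (absf (indicator Q)) \<le> ennreal K
      \<longleftrightarrow> V \<le> ennreal (K * l powr \<beta>) * vnorm s (absf (indicator Q))"
    if "0 < l" "Q = cbox a (a + l *\<^sub>R One)" for a :: 'a and l Q V
    using that vnorm_indicator_cube[of s l a, OF Pvar_ge_1[OF s] that(1)] K
    by (simp add: measure_cbox_One powr_side ennreal_ratio_le_iff)
  then show ?thesis
    unfolding osc_sup_def SUP_le_iff by (fastforce simp: cube_def)
qed

section \<open>The exponent 2, Hoelder's inequality and larger exponents\<close>

lemma Pvar_const: "1 < c \<Longrightarrow> Pvar (\<lambda>_. c)"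
  by (auto simp: Pvar_def)

lemma epowr_2: "epowr u 2 = u\<^sup>2"
  by (cases u) (auto simp: epowr_def ennreal_power)

lemma Bvar_2: "Bvar (\<lambda>_::'a::euclidean_space. 2)"
  unfolding Bvar_def
proof
  show "Pvar (\<lambda>_::'a. 2)" by (rule Pvar_const) simp
  define K where "K = 8 * (10 * real DIM('a)) ^ DIM('a)"
  have K: "0 < K" by (simp add: K_def)
  show "bounded_var HLmax (\<lambda>_::'a. 2) (\<lambda>_::'a. 2)"
  \<comment> \<open>The modular is the integral of the square, so \<open>K\<close> enters the norm
    through its root.\<close>
  proof (rule bounded_varI[of "sqrt K"])
    fix f :: "'a \<Rightarrow> real" assume f: "f \<in> borel_measurable lebesgue" "vmodular (\<lambda>_. 2) (absf f) \<le> 1"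
    have [measurable]: "HLmax f \<in> borel_measurable lebesgue" by (intro measurable_completion) simp
    have "vmodular (\<lambda>_. 2) (\<lambda>x. HLmax f x / ennreal (sqrt K)) = (\<integral>\<^sup>+ x. ennreal (1 / K) * (HLmax f x)\<^sup>2 \<partial>lebesgue)"
      unfolding vmodular_epowr epowr_2 using K
      by (intro nn_integral_cong)
         (simp add: divide_ennreal_def power_mult_distrib inverse_ennreal ennreal_power power_divide mult.commute inverse_eq_divide)
    also have "\<dots> = ennreal (1 / K) * (\<integral>\<^sup>+ x. (HLmax f x)\<^sup>2 \<partial>lebesgue)"
      by (rule nn_integral_cmult) measurable
    also have "\<dots> \<le> ennreal (1 / K) * (ennreal K * (\<integral>\<^sup>+ x. (ennreal \<bar>f x\<bar>)\<^sup>2 \<partial>lebesgue))"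
      unfolding K_def by (intro mult_left_mono HLmax_L2 f) simp
    also have "\<dots> = vmodular (\<lambda>_. 2) (absf f)"
      unfolding vmodular_epowr epowr_2 absf_def using K by (simp add: mult.assoc[symmetric] ennreal_mult'[symmetric])
    finally show "vmodular (\<lambda>_. 2) (\<lambda>x. HLmax f x / ennreal (sqrt K)) \<le> 1" using f by simp
  qed (use K HLmax_le_mult in auto)
qed

text \<open>Hoelder's inequality with conjugate exponents 1/\<theta> and 1/(1-\<theta>). Normalising
  by \<open>A\<close> and \<open>B\<close> makes it pointwise, by Young's inequality; after
  integration the two weights add up to \<open>c\<close>.\<close>

lemma nn_integral_powr_mult_le:
  assumes [measurable]: "u \<in> borel_measurable M" "v \<in> borel_measurable M"
    and nn: "\<And>x. 0 \<le> u x" "\<And>x. 0 \<le> v x" and \<theta>: "0 \<le> \<theta>" "\<theta> \<le> 1" and AB: "0 < A" "0 < B"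
    and u: "(\<integral>\<^sup>+ x. ennreal (u x) \<partial>M) \<le> ennreal A" and v: "(\<integral>\<^sup>+ x. ennreal (v x) \<partial>M) \<le> ennreal B"
  shows "(\<integral>\<^sup>+ x. ennreal (u x powr \<theta> * v x powr (1 - \<theta>)) \<partial>M) \<le> ennreal (A powr \<theta> * B powr (1 - \<theta>))"
proof -
  define c where "c = A powr \<theta> * B powr (1 - \<theta>)"
  have c: "0 < c" using AB by (simp add: c_def)
  have pt: "u x powr \<theta> * v x powr (1 - \<theta>) \<le> c * \<theta> / A * u x + c * (1 - \<theta>) / B * v x" for x
  proof (cases "u x = 0 \<or> v x = 0")
    \<comment> \<open>\<open>0 powr a\<close> is 0 for every \<open>a\<close>, also for
      \<open>a = 0\<close>, so the left side vanishes even at the end points of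
      \<open>\<theta>\<close>.\<close>
    case True
    then show ?thesis using nn[of x] \<theta> AB c by auto
  next
    case False
    then have "(u x / A) powr \<theta> * (v x / B) powr (1 - \<theta>) \<le> \<theta> * (u x / A) + (1 - \<theta>) * (v x / B)"
      using nn[of x] \<theta> AB by (intro Youngs_inequality_0) auto
    then have "c * ((u x / A) powr \<theta> * (v x / B) powr (1 - \<theta>)) \<le> c * (\<theta> * (u x / A) + (1 - \<theta>) * (v x / B))"
      using c by (intro mult_left_mono) auto
    moreover have "c * ((u x / A) powr \<theta> * (v x / B) powr (1 - \<theta>)) = u x powr \<theta> * v x powr (1 - \<theta>)"
      using AB nn by (simp add: c_def powr_divide)
    ultimately show ?thesis by (simp add: algebra_simps)
  qed
  have "(\<integral>\<^sup>+ x. ennreal (u x powr \<theta> * v x powr (1 - \<theta>)) \<partial>M)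
     \<le> (\<integral>\<^sup>+ x. ennreal (c * \<theta> / A) * ennreal (u x) + ennreal (c * (1 - \<theta>) / B) * ennreal (v x) \<partial>M)"
    using pt \<theta> AB c nn by (intro nn_integral_mono) (simp flip: ennreal_mult' ennreal_plus)
  also have "\<dots> = ennreal (c * \<theta> / A) * (\<integral>\<^sup>+ x. ennreal (u x) \<partial>M) + ennreal (c * (1 - \<theta>) / B) * (\<integral>\<^sup>+ x. ennreal (v x) \<partial>M)"
    by (simp add: nn_integral_add nn_integral_cmult)
  also have "\<dots> \<le> ennreal (c * \<theta> / A) * ennreal A + ennreal (c * (1 - \<theta>) / B) * ennreal B"
    by (intro add_mono mult_left_mono u v) auto
  also have "\<dots> = ennreal (c * \<theta> + c * (1 - \<theta>))"
    using \<theta> AB c by (simp flip: ennreal_mult' ennreal_plus)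
  also have "\<dots> = ennreal c" by (simp add: algebra_simps)
  finally show ?thesis unfolding c_def .
qed

lemma nn_integral_cube_le_HLmax:
  fixes g :: "'a::euclidean_space \<Rightarrow> real"
  assumes "0 < l" "x \<in> cbox a (a + l *\<^sub>R One)" "HLmax g x \<le> ennreal m" "0 < m"
  shows "(\<integral>\<^sup>+ y. ennreal (\<bar>g y\<bar> * indicator (cbox a (a + l *\<^sub>R One)) y) \<partial>lebesgue) \<le> ennreal (m * l ^ DIM('a))"
proof -
  let ?Q = "cbox a (a + l *\<^sub>R One)"
  let ?I = "\<integral>\<^sup>+ y. ennreal \<bar>g y\<bar> * indicator ?Q y \<partial>lebesgue"
  have "cube ?Q" using assms(1) by (auto simp: cube_def)
  from HLmax_upper[OF this assms(2), of g]
  have "ennreal (1 / l ^ DIM('a)) * ?I \<le> ennreal m"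
    using assms by (simp add: measure_cbox_One)
  then have "ennreal (l ^ DIM('a)) * (ennreal (1 / l ^ DIM('a)) * ?I) \<le> ennreal (l ^ DIM('a)) * ennreal m"
    by (intro mult_left_mono) auto
  also have "ennreal (l ^ DIM('a)) * (ennreal (1 / l ^ DIM('a)) * ?I) = ?I"
    using assms by (simp add: mult.assoc[symmetric] ennreal_mult''[symmetric])
  finally show ?thesis
    using assms by (simp add: ennreal_mult' ennreal_indicator mult.commute)
qed

text \<open>By Jensen, \<open>M f \<le> (M (|f|^(1/\<theta>)))^\<theta>\<close>; here it is
  Hoelder's inequality against the characteristic function of the cube. The powers of the volume
  combine to the volume itself.\<close>

lemma Bvar_divide:
  fixes r :: "'a::euclidean_space \<Rightarrow> real"
  assumes r: "Bvar r" and \<theta>: "0 < \<theta>" "\<theta> \<le> 1"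
  shows "Bvar (\<lambda>x. r x / \<theta>)"
  unfolding Bvar_def
proof
  have P: "Pvar r" by (rule Bvar_imp_Pvar[OF r])
  have r1: "1 \<le> r x" for x by (rule Pvar_ge_1[OF P])
  have le: "r x \<le> r x / \<theta>" for x using r1[of x] \<theta> by (simp add: le_divide_eq mult_left_le)
  obtain p0 P' where p0: "1 < p0" "AE x in lebesgue. p0 \<le> r x" "AE x in lebesgue. r x \<le> P'"
    using P unfolding Pvar_def by blast
  show "Pvar (\<lambda>x. r x / \<theta>)"
    unfolding Pvar_def
  proof (intro conjI allI)
    show "(\<lambda>x. r x / \<theta>) \<in> borel_measurable lebesgue" using Pvar_measurable[OF P] by measurable
    show "1 \<le> r x / \<theta>" for x using r1 le order_trans by blast
    have "AE x in lebesgue. p0 \<le> r x / \<theta>" using p0(2) by eventually_elim (use le order_trans in blast)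
    then show "\<exists>p0>1. AE x in lebesgue. p0 \<le> r x / \<theta>" using p0(1) by blast
    have "AE x in lebesgue. r x / \<theta> \<le> P' / \<theta>" using p0(3) by eventually_elim (use \<theta> in \<open>simp add: divide_right_mono\<close>)
    then show "\<exists>P. AE x in lebesgue. r x / \<theta> \<le> P" by blast
  qed
  have q0: "0 < r x / \<theta>" for x using r1[of x] \<theta> by simp
  show "bounded_var HLmax (\<lambda>x. r x / \<theta>) (\<lambda>x. r x / \<theta>)"
  proof (rule bounded_var_if_HLmax_dominated[OF r \<theta>(1), where K=1])
    show "AE x in lebesgue. 0 \<le> r x / \<theta>" using q0 by (intro AE_I2) (simp add: less_imp_le)
  next
    fix f :: "'a \<Rightarrow> real" assume f[measurable]: "f \<in> borel_measurable lebesgue"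
      and mod: "vmodular (\<lambda>x. r x / \<theta>) (absf f) \<le> 1"
    let ?g = "\<lambda>y. \<bar>f y\<bar> powr (1 / \<theta>)"
    have [measurable]: "?g \<in> borel_measurable lebesgue" by measurable
    have "vmodular r (absf ?g) \<le> 1"
      using mod unfolding vmodular_epowr absf_def by (simp add: epowr_ennreal powr_powr)
    moreover have "HLmax f x \<le> ennreal (1 * m powr \<theta>)" if m: "0 < m" "HLmax ?g x \<le> ennreal m" for x m
      unfolding HLmax_def
    proof (rule SUP_least, clarsimp)
      fix Q assume Q: "cube Q" "x \<in> Q"
      then obtain a l where l: "0 < l" and Qd: "Q = cbox a (a + l *\<^sub>R One)" by (auto elim!: cubeE)
      have [measurable]: "Q \<in> sets lebesgue" by (simp add: Qd)
      have "(\<integral>\<^sup>+ y. ennreal \<bar>f y\<bar> * indicator Q y \<partial>lebesgue)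
        = (\<integral>\<^sup>+ y. ennreal ((?g y * indicator Q y) powr \<theta> * (indicator Q y) powr (1 - \<theta>)) \<partial>lebesgue)"
        using \<theta> by (intro nn_integral_cong) (auto simp: indicator_def powr_powr)
      also have "\<dots> \<le> ennreal ((m * l ^ DIM('a)) powr \<theta> * (l ^ DIM('a)) powr (1 - \<theta>))"
      proof (rule nn_integral_powr_mult_le)
        show "(\<integral>\<^sup>+ y. ennreal (?g y * indicator Q y) \<partial>lebesgue) \<le> ennreal (m * l ^ DIM('a))"
          using nn_integral_cube_le_HLmax[OF l Q(2)[unfolded Qd] m(2,1)] by (simp add: Qd)
        show "(\<integral>\<^sup>+ y. ennreal (indicator Q y) \<partial>lebesgue) \<le> ennreal (l ^ DIM('a))"
          using l by (simp add: ennreal_indicator Qd emeasure_cbox_One)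
      qed (use \<theta> m l in auto)
      also have "\<dots> = ennreal (m powr \<theta> * l ^ DIM('a))"
        using m l \<theta> by (simp add: powr_mult mult.assoc powr_add[symmetric])
      finally have "ennreal (1 / measure lebesgue Q) * (\<integral>\<^sup>+ y. ennreal \<bar>f y\<bar> * indicator Q y \<partial>lebesgue)
        \<le> ennreal (1 / measure lebesgue Q) * ennreal (m powr \<theta> * l ^ DIM('a))"
        by (intro mult_left_mono) auto
      also have "\<dots> = ennreal (m powr \<theta>)"
        using l by (simp add: Qd measure_cbox_One ennreal_mult'[symmetric])
      finally show "ennreal (1 / measure lebesgue Q) * (\<integral>\<^sup>+ y. ennreal \<bar>f y\<bar> * indicator Q y \<partial>lebesgue)
        \<le> ennreal (m powr \<theta>)" .
    qed
    ultimately show "\<exists>g. g \<in> borel_measurable lebesgue \<and> vmodular r (absf g) \<le> 1 \<and>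
        (AE x in lebesgue. \<forall>m>0. HLmax g x \<le> ennreal m \<longrightarrow> HLmax f x \<le> ennreal (1 * m powr \<theta>))"
      by (intro exI[of _ ?g]) auto
  qed (use HLmax_le_mult in auto)
qed

section \<open>The maximal commutator\<close>

lemma maxcomm_upper:
  fixes b f :: "'a::euclidean_space \<Rightarrow> real"
  shows "cube Q \<Longrightarrow> x \<in> Q \<Longrightarrow>
    ennreal (measure lebesgue Q powr (\<alpha> / real DIM('a) - 1)) *
      (\<integral>\<^sup>+ y. ennreal (\<bar>b x - b y\<bar> * \<bar>f y\<bar>) * indicator Q y \<partial>lebesgue) \<le> maxcomm \<alpha> b f x"
  unfolding maxcomm_def by (rule SUP_upper) simp

lemma maxcomm_le_mult:
  fixes f b :: "'a::euclidean_space \<Rightarrow> real"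
  assumes [measurable]: "f \<in> borel_measurable lebesgue" "b \<in> borel_measurable lebesgue" and "0 < t"
  shows "maxcomm \<alpha> b f x \<le> ennreal t * maxcomm \<alpha> b (\<lambda>y. f y / t) x"
  unfolding maxcomm_def[of \<alpha> b f]
proof (rule SUP_least)
  fix Q assume "Q \<in> {Q. cube Q \<and> x \<in> Q}"
  then have Q: "cube Q" "x \<in> Q" by auto
  then have [measurable]: "Q \<in> sets lebesgue" by (auto elim!: cubeE)
  let ?c = "ennreal (measure lebesgue Q powr (\<alpha> / real DIM('a) - 1))"
  have "(\<integral>\<^sup>+ y. ennreal (\<bar>b x - b y\<bar> * \<bar>f y\<bar>) * indicator Q y \<partial>lebesgue)
      = (\<integral>\<^sup>+ y. ennreal t * (ennreal (\<bar>b x - b y\<bar> * \<bar>f y / t\<bar>) * indicator Q y) \<partial>lebesgue)"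
    using \<open>0 < t\<close> by (intro nn_integral_cong) (simp add: mult.assoc[symmetric] ennreal_mult'[symmetric])
  also have "\<dots> = ennreal t * (\<integral>\<^sup>+ y. ennreal (\<bar>b x - b y\<bar> * \<bar>f y / t\<bar>) * indicator Q y \<partial>lebesgue)"
    by (rule nn_integral_cmult) measurable
  finally have "?c * (\<integral>\<^sup>+ y. ennreal (\<bar>b x - b y\<bar> * \<bar>f y\<bar>) * indicator Q y \<partial>lebesgue)
      = ennreal t * (?c * (\<integral>\<^sup>+ y. ennreal (\<bar>b x - b y\<bar> * \<bar>f y / t\<bar>) * indicator Q y \<partial>lebesgue))"
    by (simp add: mult_ac)
  also have "\<dots> \<le> ennreal t * maxcomm \<alpha> b (\<lambda>y. f y / t) x"
    by (intro mult_left_mono maxcomm_upper Q) simp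
  finally show "?c * (\<integral>\<^sup>+ y. ennreal (\<bar>b x - b y\<bar> * \<bar>f y\<bar>) * indicator Q y \<partial>lebesgue)
    \<le> ennreal t * maxcomm \<alpha> b (\<lambda>y. f y / t) x" .
qed

lemma Lip_hom_cubeE:
  fixes b' :: "'a::euclidean_space \<Rightarrow> real"
  assumes "Lip_hom \<beta> b'" and \<beta>: "0 < \<beta>"
  obtains K where "0 < K"
    "\<And>a l x y. 0 < l \<Longrightarrow> x \<in> cbox a (a + l *\<^sub>R One) \<Longrightarrow> y \<in> cbox a (a + l *\<^sub>R One) \<Longrightarrow> \<bar>b' x - b' y\<bar> \<le> K * l powr \<beta>"
proof -
  obtain C where C: "\<And>x y. \<bar>b' x - b' y\<bar> \<le> C * dist x y powr \<beta>"
    using assms(1) unfolding Lip_hom_def by blast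
  show ?thesis
  proof (rule that)
    \<comment> \<open>The Lipschitz constant \<open>C\<close> has no given sign; the power of the
      dimension comes from the bound on distances within a cube.\<close>
    show "0 < (\<bar>C\<bar> + 1) * real DIM('a) powr \<beta>" by (simp add: add_nonneg_pos)
  next
    fix a x y :: 'a and l :: real
    assume l: "0 < l" and xy: "x \<in> cbox a (a + l *\<^sub>R One)" "y \<in> cbox a (a + l *\<^sub>R One)"
    have "dist x y powr \<beta> \<le> (real DIM('a) * l) powr \<beta>"
      using dist_le_if_mem_cbox_One[OF xy] \<beta> by (intro powr_mono2) auto
    then have "C * dist x y powr \<beta> \<le> (\<bar>C\<bar> + 1) * (real DIM('a) * l) powr \<beta>"
      by (intro mult_mono) auto
    have "\<bar>b' x - b' y\<bar> \<le> C * dist x y powr \<beta>" by (rule C)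
    also note \<open>\<dots> \<le> (\<bar>C\<bar> + 1) * (real DIM('a) * l) powr \<beta>\<close>
    finally show "\<bar>b' x - b' y\<bar> \<le> (\<bar>C\<bar> + 1) * real DIM('a) powr \<beta> * l powr \<beta>"
      using l by (simp add: powr_mult)
  qed
qed

text \<open>As \<open>b\<close> agrees with \<open>b'\<close> only almost everywhere, the pointwise
  domination is shown at points x with \<open>b x = b' x\<close>, and under the integral for almost
  every y.\<close>

lemma maxcomm_bounded_if_Lip_hom:
  fixes b :: "'a::euclidean_space \<Rightarrow> real"
  assumes b[measurable]: "b \<in> borel_measurable lebesgue" and bb': "AE x in lebesgue. b x = b' x" and Lip: "Lip_hom \<beta> b'"
    and \<beta>: "0 < \<beta>" and \<gamma>: "0 < \<alpha> + \<beta>" "\<alpha> + \<beta> < real DIM('a)" and pq: "Bgamma (\<alpha> + \<beta>) p q"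
  shows "bounded_var (maxcomm \<alpha> b) p q"
proof -
  define n where "n = real DIM('a)"
  have n: "0 < n" by (simp add: n_def)
  define \<gamma> where "\<gamma> = \<alpha> + \<beta>"
  have \<gamma>n: "0 < \<gamma>" "\<gamma> < n" using \<gamma> by (auto simp: \<gamma>_def n_def)
  define \<theta> where "\<theta> = (n - \<gamma>) / n"
  have \<theta>: "0 < \<theta>" "\<theta> \<le> 1" "1 - \<theta> = \<gamma> / n" "n * \<theta> = n - \<gamma>" using \<gamma>n n by (auto simp: \<theta>_def field_simps)
  define r where "r = (\<lambda>x. q x * (n - \<gamma>) / n)"
  have rB: "Bvar r" using pq by (simp add: Bgamma_def r_def \<gamma>_def n_def)
  have P: "Pvar p" and pq': "AE x in lebesgue. 1 / q x = 1 / p x - \<gamma> / n"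
    using pq by (auto simp: Bgamma_def n_def \<gamma>_def)
  have r1: "1 \<le> r x" for x by (rule Pvar_ge_1[OF Bvar_imp_Pvar[OF rB]])
  have p1: "1 \<le> p x" for x by (rule Pvar_ge_1[OF P])
  have q: "q x = r x / \<theta>" for x using \<gamma>n n by (simp add: r_def \<theta>_def)
  have [measurable]: "p \<in> borel_measurable lebesgue" "r \<in> borel_measurable lebesgue"
    by (auto intro: Pvar_measurable P Bvar_imp_Pvar rB)
  obtain K where K: "0 < K" and KL: "\<And>a l x y. 0 < l \<Longrightarrow> x \<in> cbox a (a + l *\<^sub>R One) \<Longrightarrow> y \<in> cbox a (a + l *\<^sub>R One) \<Longrightarrow> \<bar>b' x - b' y\<bar> \<le> K * l powr \<beta>"
    using Lip_hom_cubeE[OF Lip \<beta>] by metis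
  show ?thesis
  proof (rule bounded_var_if_HLmax_dominated[OF rB \<theta>(1) _ K])
    show "AE x in lebesgue. q x = r x / \<theta>" using q by simp
    show "AE x in lebesgue. 0 \<le> p x" using p1 by (intro AE_I2) (meson order_trans zero_le_one)
  next
    fix f :: "'a \<Rightarrow> real" assume f[measurable]: "f \<in> borel_measurable lebesgue" and mod: "vmodular p (absf f) \<le> 1"
    \<comment> \<open>With this power the \<open>r\<close>-modular of \<open>?g\<close> is the
      \<open>p\<close>-modular of \<open>f\<close>.\<close>
    let ?g = "\<lambda>y. \<bar>f y\<bar> powr (p y / r y)"
    have [measurable]: "?g \<in> borel_measurable lebesgue" by measurable
    have r0: "r x \<noteq> 0" for x using r1[of x] by linarith
    have "vmodular r (absf ?g) \<le> 1"
      using mod unfolding vmodular_epowr absf_def by (simp add: epowr_ennreal powr_powr r0)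
    moreover have "AE x in lebesgue. \<forall>m>0. HLmax ?g x \<le> ennreal m \<longrightarrow> maxcomm \<alpha> b f x \<le> ennreal (K * m powr \<theta>)"
      using bb'
    proof eventually_elim
      case (elim x)
      have "maxcomm \<alpha> b f x \<le> ennreal (K * m powr \<theta>)" if m: "0 < m" "HLmax ?g x \<le> ennreal m" for m
        unfolding maxcomm_def
      proof (rule SUP_least)
        fix Q assume "Q \<in> {Q. cube Q \<and> x \<in> Q}"
        then obtain a l where l: "0 < l" and Qd: "Q = cbox a (a + l *\<^sub>R One)" and xQ: "x \<in> Q" by (auto elim!: cubeE)
        have [measurable]: "Q \<in> sets lebesgue" by (simp add: Qd)
        \<comment> \<open>The exponents add up to 1 because \<open>\<theta> / r = 1 / q\<close> and
          \<open>1 - \<theta> = \<gamma> / n\<close>. The second factor carries no indicator: its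
          integral over the whole space is the modular of \<open>f\<close>, at most 1.\<close>
        have Hoelder: "AE y in lebesgue. \<bar>f y\<bar> * indicator Q y
            = (?g y * indicator Q y) powr \<theta> * (\<bar>f y\<bar> powr p y) powr (1 - \<theta>)"
          using pq'
        proof eventually_elim
          case (elim y)
          have "p y / r y * \<theta> + p y * (1 - \<theta>) = p y * (1 / q y + \<gamma> / n)"
            using \<theta> r0[of y] by (simp add: q distrib_left)
          also have "\<dots> = 1" using p1[of y] by (simp add: elim)
          finally have "p y / r y * \<theta> + p y * (1 - \<theta>) = 1" .
          then show ?case using \<theta> by (auto simp: indicator_def powr_powr powr_add[symmetric])
        qed
        have "(\<integral>\<^sup>+ y. ennreal (\<bar>f y\<bar> * indicator Q y) \<partial>lebesgue)
          = (\<integral>\<^sup>+ y. ennreal ((?g y * indicator Q y) powr \<theta> * (\<bar>f y\<bar> powr p y) powr (1 - \<theta>)) \<partial>lebesgue)"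
          using Hoelder by (intro nn_integral_cong_AE) auto
        also have "\<dots> \<le> ennreal ((m * l ^ DIM('a)) powr \<theta> * 1 powr (1 - \<theta>))"
        proof (rule nn_integral_powr_mult_le)
          show "(\<integral>\<^sup>+ y. ennreal (?g y * indicator Q y) \<partial>lebesgue) \<le> ennreal (m * l ^ DIM('a))"
            using nn_integral_cube_le_HLmax[OF l xQ[unfolded Qd] m(2,1)] by (simp add: Qd)
          show "(\<integral>\<^sup>+ y. ennreal (\<bar>f y\<bar> powr p y) \<partial>lebesgue) \<le> ennreal 1"
            using mod unfolding vmodular_epowr absf_def by (simp add: epowr_ennreal)
        qed (use \<theta> m l in auto)
        finally have I: "(\<integral>\<^sup>+ y. ennreal (\<bar>f y\<bar> * indicator Q y) \<partial>lebesgue) \<le> ennreal (m powr \<theta> * l powr (n - \<gamma>))"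
          using m l \<theta> by (simp add: powr_mult powr_realpow[symmetric] powr_powr n_def)
        have "(\<integral>\<^sup>+ y. ennreal (\<bar>b x - b y\<bar> * \<bar>f y\<bar>) * indicator Q y \<partial>lebesgue)
          \<le> (\<integral>\<^sup>+ y. ennreal (K * l powr \<beta>) * ennreal (\<bar>f y\<bar> * indicator Q y) \<partial>lebesgue)"
        proof (rule nn_integral_mono_AE)
          show "AE y in lebesgue. ennreal (\<bar>b x - b y\<bar> * \<bar>f y\<bar>) * indicator Q y
              \<le> ennreal (K * l powr \<beta>) * ennreal (\<bar>f y\<bar> * indicator Q y)"
            using bb'
          proof eventually_elim
            case (elim y)
            show ?case
            proof (cases "y \<in> Q")
              case True
              then have "\<bar>b x - b y\<bar> \<le> K * l powr \<beta>" using KL[OF l, of x a y] xQ \<open>b x = b' x\<close> elim by (simp add: Qd)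
              then show ?thesis using True K by (simp add: mult_right_mono ennreal_leI flip: ennreal_mult'')
            qed simp
          qed
        qed
        also have "\<dots> = ennreal (K * l powr \<beta>) * (\<integral>\<^sup>+ y. ennreal (\<bar>f y\<bar> * indicator Q y) \<partial>lebesgue)"
          by (rule nn_integral_cmult) measurable
        also have "\<dots> \<le> ennreal (K * l powr \<beta>) * ennreal (m powr \<theta> * l powr (n - \<gamma>))"
          by (intro mult_left_mono I) simp
        finally have "ennreal (measure lebesgue Q powr (\<alpha> / real DIM('a) - 1)) *
            (\<integral>\<^sup>+ y. ennreal (\<bar>b x - b y\<bar> * \<bar>f y\<bar>) * indicator Q y \<partial>lebesgue)
          \<le> ennreal (l powr (\<alpha> - n)) * (ennreal (K * l powr \<beta>) * ennreal (m powr \<theta> * l powr (n - \<gamma>)))"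
          using l powr_side[where 'a='a, OF l, of "\<alpha> - n"]
          by (intro mult_mono) (auto simp: Qd measure_cbox_One n_def diff_divide_distrib)
        also have "\<dots> = ennreal (K * m powr \<theta> * (l powr (\<alpha> - n) * l powr \<beta> * l powr (n - \<gamma>)))"
          using K by (simp add: mult_ac flip: ennreal_mult'')
        \<comment> \<open>The gain from smoothness exactly compensates the size of the cube, as
          \<open>\<gamma> = \<alpha> + \<beta>\<close>.\<close>
        also have "l powr (\<alpha> - n) * l powr \<beta> * l powr (n - \<gamma>) = 1"
          using l by (simp add: \<gamma>_def flip: powr_add)
        finally show "ennreal (measure lebesgue Q powr (\<alpha> / real DIM('a) - 1)) *
            (\<integral>\<^sup>+ y. ennreal (\<bar>b x - b y\<bar> * \<bar>f y\<bar>) * indicator Q y \<partial>lebesgue) \<le> ennreal (K * m powr \<theta>)" by simp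
      qed
      then show ?case by blast
    qed
    ultimately show "\<exists>g. g \<in> borel_measurable lebesgue \<and> vmodular r (absf g) \<le> 1 \<and>
        (AE x in lebesgue. \<forall>m>0. HLmax g x \<le> ennreal m \<longrightarrow> maxcomm \<alpha> b f x \<le> ennreal (K * m powr \<theta>))"
      by (intro exI[of _ ?g]) auto
  qed (auto intro: maxcomm_le_mult[OF _ b])
qed

text \<open>The deviation from the average is pointwise at most \<open>K * l powr \<beta>\<close>
  almost everywhere on the cube, so monotonicity of the norm suffices for every exponent.\<close>

lemma osc_sup_finite_if_Lip_hom:
  fixes b :: "'a::euclidean_space \<Rightarrow> real"
  assumes b: "locally_integrable b" and bb': "AE x in lebesgue. b x = b' x" and Lip: "Lip_hom \<beta> b'"
    and \<beta>: "0 < \<beta>" and s: "Pvar s"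
  shows "osc_sup \<beta> s b < \<infinity>"
proof -
  obtain K where K: "0 < K" and KL: "\<And>a l x y. 0 < l \<Longrightarrow> x \<in> cbox a (a + l *\<^sub>R One) \<Longrightarrow> y \<in> cbox a (a + l *\<^sub>R One) \<Longrightarrow> \<bar>b' x - b' y\<bar> \<le> K * l powr \<beta>"
    using Lip_hom_cubeE[OF Lip \<beta>] by metis
  have "osc_sup \<beta> s b \<le> ennreal K"
    unfolding osc_sup_le_iff[OF s less_imp_le[OF K]]
  proof (intro allI impI)
    fix a :: 'a and l :: real assume l: "0 < l"
    let ?Q = "cbox a (a + l *\<^sub>R One)"
    show "vnorm s (absf (\<lambda>x. (b x - avg b ?Q) * indicator ?Q x)) \<le> ennreal (K * l powr \<beta>) * vnorm s (absf (indicator ?Q))"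
    proof (rule vnorm_le_cmult)
      show "AE x in lebesgue. absf (\<lambda>x. (b x - avg b ?Q) * indicator ?Q x) x \<le> ennreal (K * l powr \<beta>) * absf (indicator ?Q) x"
        using bb'
      proof eventually_elim
        case (elim x)
        show ?case
        proof (cases "x \<in> ?Q")
          case True
          have "ennreal (\<bar>avg b ?Q - b x\<bar> * l ^ DIM('a)) \<le> (\<integral>\<^sup>+ y. ennreal \<bar>b y - b x\<bar> * indicator ?Q y \<partial>lebesgue)"
            using abs_avg_diff_le[OF locally_integrable_cbox[OF b], of a "a + l *\<^sub>R One" "b x"] l
            by (simp add: measure_cbox_One)
          also have "\<dots> \<le> (\<integral>\<^sup>+ y. ennreal (K * l powr \<beta>) * indicator ?Q y \<partial>lebesgue)"
          proof (rule nn_integral_mono_AE)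
            show "AE y in lebesgue. ennreal \<bar>b y - b x\<bar> * indicator ?Q y \<le> ennreal (K * l powr \<beta>) * indicator ?Q y"
              using bb' by eventually_elim
                (use KL[OF l _ True] \<open>b x = b' x\<close> in \<open>auto simp: indicator_def intro!: ennreal_leI\<close>)
          qed
          also have "\<dots> = ennreal (K * l powr \<beta> * l ^ DIM('a))"
            using l by (simp add: nn_integral_cmult_indicator emeasure_cbox_One ennreal_mult'')
          finally have "\<bar>avg b ?Q - b x\<bar> \<le> K * l powr \<beta>" using l K by simp
          then show ?thesis using True by (simp add: absf_def abs_minus_commute ennreal_leI)
        qed (simp add: absf_def)
      qed
      show "0 < K * l powr \<beta>" using K l by simp
      show "AE x in lebesgue. 0 \<le> s x" using Pvar_ge_1[OF s] by (intro AE_I2) (meson order_trans zero_le_one)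
    qed
  qed
  then show ?thesis by (auto intro: le_less_trans)
qed

text \<open>Put h = (b - b_Q) \<chi>_Q. The average of |h| times the norm of \<chi>_Q is at most the
  norm of \<open>M h\<close>, hence at most C R l^\<beta> times the norm of \<chi>_Q, which
  cancels.\<close>

lemma Lip_hom_if_osc_sup_finite:
  fixes b :: "'a::euclidean_space \<Rightarrow> real"
  assumes b: "locally_integrable b" and \<beta>: "0 < \<beta>" and s: "Bvar s" and fin: "osc_sup \<beta> s b < \<infinity>"
  shows "\<exists>b'. (AE x in lebesgue. b x = b' x) \<and> Lip_hom \<beta> b'"
proof -
  have P: "Pvar s" by (rule Bvar_imp_Pvar[OF s])
  have s0: "AE x in lebesgue. 0 \<le> s x" using Pvar_ge_1[OF P] by (intro AE_I2) (meson order_trans zero_le_one)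
  obtain R where R: "0 \<le> R" "osc_sup \<beta> s b = ennreal R" using fin by (cases "osc_sup \<beta> s b") auto
  obtain C0 where C0: "\<And>f. in_Lvar s f \<Longrightarrow> vnorm s (HLmax f) \<le> ennreal C0 * vnorm s (absf f)"
    using s unfolding Bvar_def bounded_var_def by blast
  define C where "C = max C0 0"
  have CM: "vnorm s (HLmax f) \<le> ennreal C * vnorm s (absf f)" if "in_Lvar s f" for f
    using C0[OF that] by (auto simp: C_def elim!: order_trans intro!: mult_right_mono ennreal_leI)
  have C: "0 \<le> C" by (simp add: C_def)
  show ?thesis
  proof (rule Campanato_imp_Lip_hom[OF b \<beta>])
    show "0 \<le> C * R" using C R by simp
  next
    fix a :: 'a and l :: real assume l: "0 < l"
    let ?Q = "cbox a (a + l *\<^sub>R One)"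
    let ?h = "\<lambda>x. (b x - avg b ?Q) * indicator ?Q x"
    let ?I = "\<integral>\<^sup>+ y. ennreal \<bar>b y - avg b ?Q\<bar> * indicator ?Q y \<partial>lebesgue"
    have Q: "cube ?Q" using l by (auto simp: cube_def)
    obtain \<nu> where \<nu>: "0 < \<nu>" "vnorm s (absf (indicator ?Q)) = ennreal \<nu>"
      using vnorm_indicator_cube[of s l a, OF Pvar_ge_1[OF P] l] by (cases "vnorm s (absf (indicator ?Q))") auto
    have h: "vnorm s (absf ?h) \<le> ennreal (R * l powr \<beta> * \<nu>)"
      using osc_sup_le_iff[OF P R(1), THEN iffD1, OF eq_refl[OF R(2)], rule_format, OF l, of a] \<nu>
      by (simp add: ennreal_mult'')
    have [measurable]: "?Q \<in> sets lebesgue" by simp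
    have hm: "?h \<in> borel_measurable lebesgue"
      using borel_measurable_locally_integrable[OF b] by measurable
    have "in_Lvar s ?h" using h hm by (auto simp: in_Lvar_def intro: le_less_trans)
    then have "vnorm s (HLmax ?h) \<le> ennreal C * vnorm s (absf ?h)" by (rule CM)
    also have "\<dots> \<le> ennreal C * ennreal (R * l powr \<beta> * \<nu>)" by (intro mult_left_mono h) simp
    finally have M: "vnorm s (HLmax ?h) \<le> ennreal (C * R * l powr \<beta> * \<nu>)"
      using C by (simp add: mult.assoc ennreal_mult')
    have w: "ennreal (1 / l ^ DIM('a)) * ?I \<le> HLmax ?h x" if "x \<in> ?Q" for x
      using HLmax_upper[OF Q that, of ?h] l by (simp add: measure_cbox_One abs_mult ennreal_mult'' ennreal_indicator mult.assoc indicator_inter_arith[symmetric])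
    show "?I \<le> ennreal (C * R * l powr \<beta> * l ^ DIM('a))"
    proof (rule ccontr)
      assume "\<not> ?I \<le> ennreal (C * R * l powr \<beta> * l ^ DIM('a))"
      then have "ennreal (C * R * l powr \<beta> * l ^ DIM('a)) < ?I" by simp
      \<comment> \<open>A real number strictly in between replaces \<open>?I\<close>, whose
        finiteness has not been shown; on the cube \<open>HLmax ?h\<close> is at least
        \<open>i / l^n\<close>.\<close>
      then obtain z where z: "ennreal (C * R * l powr \<beta> * l ^ DIM('a)) < z" "z < ?I" using dense by blast
      then obtain i where i: "0 \<le> i" "z = ennreal i" by (cases z) auto
      have i': "C * R * l powr \<beta> * l ^ DIM('a) < i" using z i C R l by (simp add: ennreal_less_iff)
      moreover have "0 \<le> C * R * l powr \<beta> * l ^ DIM('a)" using C R l by simp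
      ultimately have i0: "0 < i" by linarith
      have "vnorm s (absf (indicator ?Q)) \<le> ennreal (l ^ DIM('a) / i) * vnorm s (HLmax ?h)"
      proof (rule vnorm_le_cmult[OF AE_I2 _ s0])
        fix x
        show "absf (indicator ?Q) x \<le> ennreal (l ^ DIM('a) / i) * HLmax ?h x"
        proof (cases "x \<in> ?Q")
          case True
          have "absf (indicator ?Q) x = ennreal (l ^ DIM('a) / i) * (ennreal (1 / l ^ DIM('a)) * ennreal i)"
            using True i0 l by (simp add: absf_def flip: ennreal_mult' ennreal_1)
          also have "\<dots> \<le> ennreal (l ^ DIM('a) / i) * HLmax ?h x"
            using z i by (intro mult_left_mono order_trans[OF _ w[OF True]]) auto
          finally show ?thesis .
        qed (simp add: absf_def)
      qed (use l i0 in simp)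
      also have "\<dots> \<le> ennreal (l ^ DIM('a) / i) * ennreal (C * R * l powr \<beta> * \<nu>)" by (intro mult_left_mono M) simp
      also have "\<dots> = ennreal (C * R * l powr \<beta> * l ^ DIM('a) / i * \<nu>)"
        using l i0 by (simp add: mult_ac flip: ennreal_mult')
      finally have "1 * \<nu> \<le> C * R * l powr \<beta> * l ^ DIM('a) / i * \<nu>"
        using \<nu> C R l i0 by simp
      then have "1 \<le> C * R * l powr \<beta> * l ^ DIM('a) / i" using \<nu>(1) by (simp only: mult_le_cancel_right_pos)
      then show False using i' i0 by simp
    qed
  qed
qed

text \<open>With weights p/q and p \<gamma>/n, which add up to 1, Young's inequality gives t^(-p)
  l^(-\<gamma> p) \<le> t^(-q) + l^(-n). Both terms on the right have integral at most 1 over the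
  cube.\<close>

lemma vnorm_indicator_cube_le:
  fixes p q :: "'a::euclidean_space \<Rightarrow> real"
  assumes l: "0 < l" and \<gamma>: "0 < \<gamma>" and p: "\<And>x. 1 \<le> p x" and q: "\<And>x. 1 \<le> q x"
    and [measurable]: "q \<in> borel_measurable lebesgue"
    and pq: "AE x in lebesgue. 1 / q x = 1 / p x - \<gamma> / real DIM('a)"
  shows "vnorm p (absf (indicator (cbox a (a + l *\<^sub>R One))))
    \<le> ennreal (4 * l powr \<gamma>) * vnorm q (absf (indicator (cbox a (a + l *\<^sub>R One))))"
proof -
  let ?Q = "cbox a (a + l *\<^sub>R One)"
  obtain \<nu> where \<nu>: "0 < \<nu>" "vnorm q (absf (indicator ?Q)) = ennreal \<nu>"
    using vnorm_indicator_cube[of q l a, OF q l] by (cases "vnorm q (absf (indicator ?Q))") auto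
  \<comment> \<open>Strictly above the norm, so that the modular at \<open>t\<close> is at most
    1.\<close>
  define t where "t = 2 * \<nu>"
  have t: "0 < t" using \<nu> by (simp add: t_def)
  have q0: "AE x in lebesgue. 0 \<le> q x" using q by (intro AE_I2) (meson order_trans zero_le_one)
  have "vmodular q (\<lambda>x. absf (indicator ?Q) x / ennreal t) \<le> 1"
    by (rule vmodular_le_1_if_vnorm_less) (use \<nu> q0 in \<open>auto simp: t_def ennreal_less_iff\<close>)
  then have mq: "(\<integral>\<^sup>+ x. ennreal ((1 / t) powr q x) * indicator ?Q x \<partial>lebesgue) \<le> 1"
    by (simp add: vmodular_indicator_divide t)
  have [measurable]: "?Q \<in> sets lebesgue" by simp
  \<comment> \<open>The additional 2, raised to a power \<open>p x \<ge> 1\<close>, halves the sum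
    of the two integrals; together with the 2 in \<open>t\<close> it yields the constant 4.\<close>
  define T where "T = 2 * l powr \<gamma> * t"
  have T: "0 < T" using l t by (simp add: T_def)
  have pt: "AE x in lebesgue. (1 / T) powr p x \<le> 1 / 2 * (1 / t) powr q x + 1 / 2 * (1 / l ^ DIM('a))"
    using pq
  proof eventually_elim
    case (elim x)
    have p0: "0 < p x" and q0: "0 < q x" using p[of x] q[of x] by auto
    define \<eta> where "\<eta> = p x / q x"
    define \<zeta> where "\<zeta> = p x * (\<gamma> / DIM('a))"
    have pq1: "\<eta> + \<zeta> = 1"
    proof -
      have "\<eta> + \<zeta> = p x * (1 / q x + \<gamma> / DIM('a))" by (simp add: \<eta>_def \<zeta>_def distrib_left)
      then show ?thesis using elim p0 by simp
    qed
    have nn: "0 \<le> \<eta>" "0 \<le> \<zeta>" using p0 q0 \<gamma> by (auto simp: \<eta>_def \<zeta>_def)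
    have "(1 / t) powr p x * (1 / l powr \<gamma>) powr p x = ((1 / t) powr q x) powr \<eta> * (1 / l ^ DIM('a)) powr \<zeta>"
      using q0 l t by (simp add: powr_powr \<eta>_def \<zeta>_def powr_divide mult.commute flip: powr_realpow)
    also have "\<dots> \<le> \<eta> * (1 / t) powr q x + \<zeta> * (1 / l ^ DIM('a))"
      using l t nn pq1 by (intro Youngs_inequality_0) auto
    also have "\<dots> \<le> 1 * (1 / t) powr q x + 1 * (1 / l ^ DIM('a))"
      using l nn pq1 by (intro add_mono mult_right_mono) auto
    finally have Y: "(1 / t) powr p x * (1 / l powr \<gamma>) powr p x \<le> (1 / t) powr q x + 1 / l ^ DIM('a)" by simp
    have "(1 / T) powr p x = (1 / 2) powr p x * ((1 / t) powr p x * (1 / l powr \<gamma>) powr p x)"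
      using l t by (simp add: T_def powr_mult[symmetric] mult_ac)
    also have "\<dots> \<le> (1 / 2) * ((1 / t) powr q x + 1 / l ^ DIM('a))"
      using powr_mono'[of 1 "p x" "1 / 2 :: real"] p Y by (intro mult_mono) auto
    finally show ?case by (simp add: distrib_left)
  qed
  have "vmodular p (\<lambda>x. absf (indicator ?Q) x / ennreal T)
    \<le> (\<integral>\<^sup>+ x. ennreal (1 / 2) * (ennreal ((1 / t) powr q x) * indicator ?Q x)
        + ennreal (1 / 2 * (1 / l ^ DIM('a))) * indicator ?Q x \<partial>lebesgue)"
    unfolding vmodular_indicator_divide[OF T]
  proof (rule nn_integral_mono_AE)
    show "AE x in lebesgue. ennreal ((1 / T) powr p x) * indicator ?Q x
       \<le> ennreal (1 / 2) * (ennreal ((1 / t) powr q x) * indicator ?Q x) + ennreal (1 / 2 * (1 / l ^ DIM('a))) * indicator ?Q x"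
      using pt
    proof eventually_elim
      case (elim x)
      have "ennreal (1 / 2 * (1 / t) powr q x + 1 / 2 * (1 / l ^ DIM('a)))
          = ennreal (1 / 2) * ennreal ((1 / t) powr q x) + ennreal (1 / 2 * (1 / l ^ DIM('a)))"
        using l by (subst ennreal_plus) (auto simp only: ennreal_mult'[symmetric] intro!: mult_nonneg_nonneg, simp_all)
      then show ?case using ennreal_leI[OF elim] by (auto simp only: indicator_simps mult_1_right mult_zero_right add_0_right order_refl split: split_indicator)
    qed
  qed
  also have "\<dots> = ennreal (1 / 2) * (\<integral>\<^sup>+ x. ennreal ((1 / t) powr q x) * indicator ?Q x \<partial>lebesgue)
      + ennreal (1 / 2 * (1 / l ^ DIM('a))) * emeasure lebesgue ?Q"
    by (subst nn_integral_add, measurable, subst nn_integral_cmult, measurable, subst nn_integral_cmult_indicator) auto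
  also have "\<dots> \<le> ennreal (1 / 2) * 1 + ennreal (1 / 2 * (1 / l ^ DIM('a))) * ennreal (l ^ DIM('a))"
    using l by (intro add_mono mult_left_mono mq) (auto simp: emeasure_cbox_One)
  also have "ennreal (1 / 2 * (1 / l ^ DIM('a))) * ennreal (l ^ DIM('a)) = ennreal (1 / 2)"
    using l by (subst ennreal_mult'[symmetric]) auto
  also have "ennreal (1 / 2) * 1 + ennreal (1 / 2) = 1"
    using ennreal_plus[of "1 / 2" "1 / 2"] by simp
  finally have "vnorm p (absf (indicator ?Q)) \<le> ennreal T" using T by (intro vnorm_le) auto
  then show ?thesis using l \<nu> by (simp add: T_def t_def mult_ac flip: ennreal_mult')
qed

text \<open>For x in Q the integral of |b x - b y| over Q is at least |Q| |b x - b_Q|, so the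
  commutator of \<chi>_Q at x is at least l^\<alpha> |b x - b_Q|. Boundedness and the comparison of
  norms give the factor l^(-\<alpha>) l^(\<alpha>+\<beta>) = l^\<beta>.\<close>

lemma osc_sup_finite_if_maxcomm_bounded:
  fixes b :: "'a::euclidean_space \<Rightarrow> real"
  assumes b: "locally_integrable b" and \<gamma>: "0 < \<alpha> + \<beta>"
    and p: "\<And>x. 1 \<le> p x" and q: "Pvar q"
    and pq: "AE x in lebesgue. 1 / q x = 1 / p x - (\<alpha> + \<beta>) / real DIM('a)"
    and bdd: "bounded_var (maxcomm \<alpha> b) p q"
  shows "osc_sup \<beta> q b < \<infinity>"
proof -
  obtain C0 where C0: "\<And>f. in_Lvar p f \<Longrightarrow> vnorm q (maxcomm \<alpha> b f) \<le> ennreal C0 * vnorm p (absf f)"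
    using bdd unfolding bounded_var_def by blast
  define C where "C = max C0 0"
  have C: "0 \<le> C" by (simp add: C_def)
  have "osc_sup \<beta> q b \<le> ennreal (4 * C)"
  proof (subst osc_sup_le_iff[OF q], use C in simp, intro allI impI)
    fix a :: 'a and l :: real assume l: "0 < l"
    let ?Q = "cbox a (a + l *\<^sub>R One)"
    let ?h = "\<lambda>x. (b x - avg b ?Q) * indicator ?Q x"
    have Q: "cube ?Q" using l by (auto simp: cube_def)
    have "vnorm q (absf ?h) \<le> ennreal (l powr - \<alpha>) * vnorm q (maxcomm \<alpha> b (indicator ?Q))"
    proof (rule vnorm_le_cmult[OF AE_I2])
      fix x
      show "absf ?h x \<le> ennreal (l powr - \<alpha>) * maxcomm \<alpha> b (indicator ?Q) x"
      proof (cases "x \<in> ?Q")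
        case True
        have "ennreal (\<bar>avg b ?Q - b x\<bar> * l ^ DIM('a)) \<le> (\<integral>\<^sup>+ y. ennreal \<bar>b y - b x\<bar> * indicator ?Q y \<partial>lebesgue)"
          using abs_avg_diff_le[OF locally_integrable_cbox[OF b], of a "a + l *\<^sub>R One" "b x"] l
          by (simp add: measure_cbox_One)
        also have "\<dots> = (\<integral>\<^sup>+ y. ennreal (\<bar>b x - b y\<bar> * \<bar>indicator ?Q y\<bar>) * indicator ?Q y \<partial>lebesgue)"
          by (intro nn_integral_cong) (auto simp: indicator_def abs_minus_commute)
        finally have "ennreal (l powr - \<alpha>) * (ennreal (l powr (\<alpha> - DIM('a))) * ennreal (\<bar>avg b ?Q - b x\<bar> * l ^ DIM('a)))
          \<le> ennreal (l powr - \<alpha>) * (ennreal (measure lebesgue ?Q powr (\<alpha> / real DIM('a) - 1)) *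
             (\<integral>\<^sup>+ y. ennreal (\<bar>b x - b y\<bar> * \<bar>indicator ?Q y\<bar>) * indicator ?Q y \<partial>lebesgue))"
          using l powr_side[where 'a='a, OF l, of "\<alpha> - DIM('a)"]
          by (intro mult_left_mono mult_mono) (auto simp: measure_cbox_One diff_divide_distrib)
        also have "\<dots> \<le> ennreal (l powr - \<alpha>) * maxcomm \<alpha> b (indicator ?Q) x"
          by (intro mult_left_mono maxcomm_upper Q True) simp
        also have "ennreal (l powr - \<alpha>) * (ennreal (l powr (\<alpha> - DIM('a))) * ennreal (\<bar>avg b ?Q - b x\<bar> * l ^ DIM('a)))
           = ennreal (\<bar>avg b ?Q - b x\<bar> * (l powr - \<alpha> * l powr (\<alpha> - DIM('a)) * l powr DIM('a)))"
          using l by (simp add: mult_ac powr_realpow flip: ennreal_mult')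
        also have "l powr - \<alpha> * l powr (\<alpha> - DIM('a)) * l powr DIM('a) = 1"
          using l by (simp flip: powr_add)
        finally show ?thesis using True by (simp add: absf_def abs_minus_commute)
      qed (simp add: absf_def)
    qed (use l Pvar_ge_1[OF q] in \<open>auto intro!: AE_I2 intro: order_trans[OF zero_le_one]\<close>)
    also have "vnorm q (maxcomm \<alpha> b (indicator ?Q)) \<le> ennreal C * vnorm p (absf (indicator ?Q))"
    proof -
      have "in_Lvar p (indicator ?Q)"
        using vnorm_indicator_cube(2)[of p l a, OF p l] by (simp add: in_Lvar_def borel_measurable_indicator)
      from C0[OF this] show ?thesis
        by (rule order_trans) (auto simp: C_def intro!: mult_right_mono ennreal_leI)
    qed
    also have "vnorm p (absf (indicator ?Q)) \<le> ennreal (4 * l powr (\<alpha> + \<beta>)) * vnorm q (absf (indicator ?Q))"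
      by (rule vnorm_indicator_cube_le[OF l \<gamma> p Pvar_ge_1[OF q] Pvar_measurable[OF q] pq])
    finally have "vnorm q (absf ?h) \<le> ennreal (l powr - \<alpha>) * (ennreal C * (ennreal (4 * l powr (\<alpha> + \<beta>)) * vnorm q (absf (indicator ?Q))))"
      by (simp add: mult_left_mono)
    also have "\<dots> = ennreal (4 * C * (l powr - \<alpha> * l powr (\<alpha> + \<beta>))) * vnorm q (absf (indicator ?Q))"
    proof -
      have "ennreal (l powr - \<alpha>) * (ennreal C * ennreal (4 * l powr (\<alpha> + \<beta>))) = ennreal (4 * C * (l powr - \<alpha> * l powr (\<alpha> + \<beta>)))"
        by (subst ennreal_mult'[symmetric], fact C, subst ennreal_mult'[symmetric], simp) (simp only: mult_ac)
      then show ?thesis by (simp only: mult.assoc[symmetric])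
    qed
    also have "l powr - \<alpha> * l powr (\<alpha> + \<beta>) = l powr \<beta>" by (simp flip: powr_add)
    finally show "vnorm q (absf ?h) \<le> ennreal (4 * C * l powr \<beta>) * vnorm q (absf (indicator ?Q))" .
  qed
  then show ?thesis by (auto intro: le_less_trans)
qed

text \<open>The definition makes only the smaller exponent q (n - \<gamma>)/n admissible;
  \<open>Bvar_divide\<close> raises it to \<open>q\<close>.\<close>

lemma Bgamma_imp_Bvar:
  fixes q :: "'a::euclidean_space \<Rightarrow> real"
  assumes "Bgamma \<gamma> p q" "0 < \<gamma>" "\<gamma> < real DIM('a)"
  shows "Bvar q"
proof -
  have "Bvar (\<lambda>x. q x * (real DIM('a) - \<gamma>) / real DIM('a))"
    using assms(1) unfolding Bgamma_def by blast
  then have "Bvar (\<lambda>x. q x * (real DIM('a) - \<gamma>) / real DIM('a) / ((real DIM('a) - \<gamma>) / real DIM('a)))"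
    by (rule Bvar_divide) (use assms in simp_all)
  then show ?thesis using assms by simp
qed

text \<open>\<open>q\<close> is chosen so that q (n - \<gamma>)/n = 2, and \<open>p\<close> is then
  forced; p < n/\<gamma> amounts to \<gamma> < n.\<close>

lemma Bgamma_const:
  assumes "0 < \<gamma>" "\<gamma> < real DIM('a)"
  shows "Bgamma \<gamma> (\<lambda>_::'a::euclidean_space. 2 * real DIM('a) / (real DIM('a) + \<gamma>))
    (\<lambda>_. 2 * real DIM('a) / (real DIM('a) - \<gamma>))"
  unfolding Bgamma_def
proof (intro conjI)
  let ?n = "real DIM('a)"
  show "Pvar (\<lambda>_::'a. 2 * ?n / (?n + \<gamma>))" using assms by (intro Pvar_const) (simp add: field_simps)
  have "2 * ?n / (?n + \<gamma>) < ?n / \<gamma>"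
    using assms by (simp add: field_simps)
  then show "\<exists>P<?n / \<gamma>. AE x::'a in lebesgue. 2 * ?n / (?n + \<gamma>) \<le> P" by (intro exI[of _ "2 * ?n / (?n + \<gamma>)"]) simp
  have "1 / (2 * ?n / (?n - \<gamma>)) = 1 / (2 * ?n / (?n + \<gamma>)) - \<gamma> / ?n"
    using assms by (simp add: field_simps)
  then show "AE x::'a in lebesgue. 1 / (2 * ?n / (?n - \<gamma>)) = 1 / (2 * ?n / (?n + \<gamma>)) - \<gamma> / ?n" by simp
  show "Bvar (\<lambda>x::'a. 2 * ?n / (?n - \<gamma>) * (?n - \<gamma>) / ?n)" using assms Bvar_2 by simp
qed

text \<open>Changing \<open>b\<close> on a null set affects none of (2) to (5) but may destroy
  \<open>Lip_hom\<close>; hence (1) speaks of a function that equals \<open>b\<close> almost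
  everywhere.\<close>

theorem theorem1p3:
  fixes b :: "'a::euclidean_space \<Rightarrow> real" and \<alpha> \<beta> :: real
  assumes "0 < \<beta>" "\<beta> < 1" "0 < \<alpha>" "\<alpha> < real DIM('a)" "\<alpha> + \<beta> < real DIM('a)"
    and "locally_integrable b"
  shows "((\<exists>b'. (AE x in lebesgue. b x = b' x) \<and> Lip_hom \<beta> b')
            \<longleftrightarrow> (\<exists>p q. Bgamma (\<alpha> + \<beta>) p q \<and> bounded_var (maxcomm \<alpha> b) p q))
       \<and> ((\<exists>p q. Bgamma (\<alpha> + \<beta>) p q \<and> bounded_var (maxcomm \<alpha> b) p q)
            \<longleftrightarrow> (\<forall>p q. Bgamma (\<alpha> + \<beta>) p q \<longrightarrow> bounded_var (maxcomm \<alpha> b) p q))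
       \<and> ((\<forall>p q. Bgamma (\<alpha> + \<beta>) p q \<longrightarrow> bounded_var (maxcomm \<alpha> b) p q)
            \<longleftrightarrow> (\<exists>s. Bvar s \<and> osc_sup \<beta> s b < \<infinity>))
       \<and> ((\<exists>s. Bvar s \<and> osc_sup \<beta> s b < \<infinity>)
            \<longleftrightarrow> (\<forall>s. Bvar s \<longrightarrow> osc_sup \<beta> s b < \<infinity>))"
    (is "(?S1 \<longleftrightarrow> ?S2) \<and> (_ \<longleftrightarrow> ?S3) \<and> (_ \<longleftrightarrow> ?S4) \<and> (_ \<longleftrightarrow> ?S5)")
proof -
  have \<gamma>: "0 < \<alpha> + \<beta>" using assms by simp
  \<comment> \<open>The implications form the cycle (1), (3), (2), (4), (1), with (5) attached by
    (1) to (5) to (4).\<close>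
  have "?S3" if ?S1
    using that maxcomm_bounded_if_Lip_hom[OF borel_measurable_locally_integrable[OF assms(6)] _ _ assms(1) \<gamma> assms(5)]
    by blast
  moreover have "?S2" if ?S3
    using that Bgamma_const[OF \<gamma> assms(5)] by blast
  moreover have "?S4" if S2: ?S2
  proof -
    obtain p q where pq: "Bgamma (\<alpha> + \<beta>) p q" "bounded_var (maxcomm \<alpha> b) p q" using S2 by blast
    have q: "Bvar q" by (rule Bgamma_imp_Bvar[OF pq(1) \<gamma> assms(5)])
    have "osc_sup \<beta> q b < \<infinity>"
      using pq by (intro osc_sup_finite_if_maxcomm_bounded[OF assms(6) \<gamma> _ Bvar_imp_Pvar[OF q] _ pq(2)])
        (auto simp: Bgamma_def Pvar_ge_1)
    with q show ?thesis by blast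
  qed
  moreover have "?S1" if ?S4
    using that Lip_hom_if_osc_sup_finite[OF assms(6,1)] by blast
  moreover have "?S5" if ?S1
    using that osc_sup_finite_if_Lip_hom[OF assms(6) _ _ assms(1) Bvar_imp_Pvar] by blast
  moreover have "?S4" if ?S5
    using that Bvar_2 by blast
  ultimately show ?thesis by argo
qed

end
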